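(* There exists a $2$-star aligned graph $(G,\mathcal X)$ of alignment complexity $(\bot,1,\bot)$ (that is, every edge has exactly one endpoint on a pseudoline and is crossed in its interior by at most one pseudoline) that does not have an aligned drawing.
   Context: Let $G$ be a planar graph with a fixed planar embedding (drawing). A pseudoline with respect to $G$ is a simple curve, unbounded in both directions, that starts and ends in the outer face of $G$ and that, for each edge of $G$, either entirely contains that edge or intersects it at most once. An aligned graph is a pair $(G,\mathcal A)$ where $\mathcal A=\{\mathcal L_1,\dots,\mathcal L_k\}$ is a set of pseudolines with respect to $G$ that pairwise intersect at most once. The pseudolines divide the plane into cells. An aligned drawing of $(G,\mathcal A)$ is a pair $(\Gamma,A)$ where $\Gamma$ is a planar straight-line drawing of $G$ and $A=\{L_1,\dots,L_k\}$ is a set of straight lines ($L_i$ corresponding to $\mathcal L_i$) such that: (i) the arrangement $A$ is homeomorphic to the arrangement $\mathcal A$, which induces a bijection $\phi$ from the cells of $\mathcal A$ to the cells of $A$; (ii) $\Gamma$ is homeomorphic to the given planar embedding of $G$; (iii) a vertex or edge intersects a cell $C$ of $\mathcal A$ if and only if it intersects $\phi(C)$ in $(\Gamma,A)$; (iv) if an edge $uv$, traversed from $u$ to $v$, intersects cells $C_1,\dots,C_r$ in this order, then in $\Gamma$ it intersects $\phi(C_1),\dots,\phi(C_r)$ in this order; (v) each line $L_i$ intersects in $\Gamma$ the same vertices and edges as $\mathcal L_i$ in $G$, in the same order. An aligned graph $(G,\mathcal X)$ with $\mathcal X=\{\mathcal X_1,\dots,\mathcal X_k\}$ is a $k$-star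 aligned graph if all pseudolines pairwise intersect in one common point (the origin). An edge is $l$-crossed if exactly $l$ pseudolines intersect it in its interior; it is $i$-anchored if $i$ of its endpoints lie on $i$ distinct pseudolines. Let $E_i$ denote the set of $i$-anchored edges. For $l_0,l_1,l_2\in\mathbb N\cup\{\bot\}$, the aligned graph has alignment complexity $(l_0,l_1,l_2)$ if, for each $i$, $E_i$ is empty when $l_i=\bot$, and every edge of $E_i$ is at most $l_i$-crossed otherwise. *)

theory Defs
  imports "HOL-Analysis.Analysis"
begin

type_synonym pt = "real^2"

text \<open>Graphs: vertex set V of naturals, edges as ordered pairs (an orientation of each
undirected edge is fixed, the traversal direction used in condition (iv)).
A drawing assigns points to vertices and arcs (injective paths on [0,1]) to edges.\<close>

definition plane_drawing ::
  "nat set \<Rightarrow> (nat \<times> nat) set \<Rightarrow> (nat \<Rightarrow> pt) \<Rightarrow> (nat \<times> nat \<Rightarrow> real \<Rightarrow> pt) \<Rightarrow> bool" where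
  "plane_drawing V E pos c \<longleftrightarrow>
     finite V \<and> E \<subseteq> V \<times> V \<and> (\<forall>(u,v)\<in>E. u \<noteq> v \<and> (v,u) \<notin> E) \<and>
     inj_on pos V \<and>
     (\<forall>e\<in>E. arc (c e) \<and> pathstart (c e) = pos (fst e) \<and> pathfinish (c e) = pos (snd e)) \<and>
     (\<forall>e\<in>E. \<forall>w\<in>V. pos w \<notin> c e ` {0<..<1}) \<and>
     (\<forall>e\<in>E. \<forall>e'\<in>E. e \<noteq> e' \<longrightarrow>
        path_image (c e) \<inter> path_image (c e') \<subseteq> pos ` ({fst e, snd e} \<inter> {fst e', snd e'}))"

definition drawing_set ::
  "nat set \<Rightarrow> (nat \<times> nat) set \<Rightarrow> (nat \<Rightarrow> pt) \<Rightarrow> (nat \<times> nat \<Rightarrow> real \<Rightarrow> pt) \<Rightarrow> pt set" where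
  "drawing_set V E pos c = pos ` V \<union> (\<Union>e\<in>E. path_image (c e))"

definition crosses_at :: "(real \<Rightarrow> pt) \<Rightarrow> (real \<Rightarrow> pt) \<Rightarrow> real \<Rightarrow> bool" where
  "crosses_at l \<gamma> t \<longleftrightarrow>
     (\<exists>\<epsilon>>0. \<forall>a b. t - \<epsilon> < a \<and> a < t \<and> t < b \<and> b < t + \<epsilon> \<longrightarrow>
        \<gamma> a \<notin> range l \<and> \<gamma> b \<notin> range l \<and> \<not> connected_component (- range l) (\<gamma> a) (\<gamma> b))"

definition pseudoline ::
  "nat set \<Rightarrow> (nat \<times> nat) set \<Rightarrow> (nat \<Rightarrow> pt) \<Rightarrow> (nat \<times> nat \<Rightarrow> real \<Rightarrow> pt) \<Rightarrow> (real \<Rightarrow> pt) \<Rightarrow> bool" where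
  "pseudoline V E pos c l \<longleftrightarrow>
     continuous_on UNIV l \<and> inj l \<and>
     filterlim (\<lambda>t. norm (l t)) at_top at_top \<and> filterlim (\<lambda>t. norm (l t)) at_top at_bot \<and>
     eventually (\<lambda>t. l t \<in> outside (drawing_set V E pos c)) at_top \<and>
     eventually (\<lambda>t. l t \<in> outside (drawing_set V E pos c)) at_bot \<and>
     (\<forall>e\<in>E. path_image (c e) \<subseteq> range l \<or>
        ((\<forall>p q. p \<in> path_image (c e) \<inter> range l \<and> q \<in> path_image (c e) \<inter> range l \<longrightarrow> p = q) \<and>
         (\<forall>t\<in>{0<..<1}. c e t \<in> range l \<longrightarrow> crosses_at l (c e) t)))"

definition aligned_graph ::
  "nat set \<Rightarrow> (nat \<times> nat) set \<Rightarrow> (nat \<Rightarrow> pt) \<Rightarrow> (nat \<times> nat \<Rightarrow> real \<Rightarrow> pt) \<Rightarrow> nat \<Rightarrow> (nat \<Rightarrow> real \<Rightarrow> pt) \<Rightarrow> bool" where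
  "aligned_graph V E pos c k X \<longleftrightarrow>
     plane_drawing V E pos c \<and>
     (\<forall>i<k. pseudoline V E pos c (X i)) \<and>
     (\<forall>i<k. \<forall>j<k. i \<noteq> j \<longrightarrow>
        (\<forall>p q. p \<in> range (X i) \<inter> range (X j) \<and> q \<in> range (X i) \<inter> range (X j) \<longrightarrow> p = q) \<and>
        (\<forall>s. X j s \<in> range (X i) \<longrightarrow> crosses_at (X i) (X j) s))"

definition star_aligned_graph ::
  "nat set \<Rightarrow> (nat \<times> nat) set \<Rightarrow> (nat \<Rightarrow> pt) \<Rightarrow> (nat \<times> nat \<Rightarrow> real \<Rightarrow> pt) \<Rightarrow> nat \<Rightarrow> (nat \<Rightarrow> real \<Rightarrow> pt) \<Rightarrow> bool" where
  "star_aligned_graph V E pos c k X \<longleftrightarrow>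
     aligned_graph V E pos c k X \<and>
     (\<exists>org. \<forall>i<k. \<forall>j<k. i \<noteq> j \<longrightarrow> range (X i) \<inter> range (X j) = {org})"

text \<open>Anchoring: e is i-anchored iff i is the largest number of its endpoints that can be
placed on pairwise distinct pseudolines.\<close>

definition on_pl :: "nat \<Rightarrow> (nat \<Rightarrow> real \<Rightarrow> pt) \<Rightarrow> pt \<Rightarrow> bool" where
  "on_pl k X p \<longleftrightarrow> (\<exists>i<k. p \<in> range (X i))"

definition anchoring :: "(nat \<Rightarrow> pt) \<Rightarrow> nat \<Rightarrow> (nat \<Rightarrow> real \<Rightarrow> pt) \<Rightarrow> nat \<times> nat \<Rightarrow> nat" where
  "anchoring pos k X e =
     (if \<exists>i<k. \<exists>j<k. i \<noteq> j \<and> pos (fst e) \<in> range (X i) \<and> pos (snd e) \<in> range (X j) then 2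
      else if on_pl k X (pos (fst e)) \<or> on_pl k X (pos (snd e)) then 1 else 0)"

definition crossing_number ::
  "(nat \<times> nat \<Rightarrow> real \<Rightarrow> pt) \<Rightarrow> nat \<Rightarrow> (nat \<Rightarrow> real \<Rightarrow> pt) \<Rightarrow> nat \<times> nat \<Rightarrow> nat" where
  "crossing_number c k X e = card {i. i < k \<and> range (X i) \<inter> c e ` {0<..<1} \<noteq> {}}"

text \<open>Alignment complexity (l0,l1,l2); None encodes \<open>\<bottom>\<close>.\<close>

definition alignment_complexity ::
  "(nat \<times> nat) set \<Rightarrow> (nat \<Rightarrow> pt) \<Rightarrow> (nat \<times> nat \<Rightarrow> real \<Rightarrow> pt) \<Rightarrow> nat \<Rightarrow> (nat \<Rightarrow> real \<Rightarrow> pt)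
     \<Rightarrow> nat option \<Rightarrow> nat option \<Rightarrow> nat option \<Rightarrow> bool" where
  "alignment_complexity E pos c k X l0 l1 l2 \<longleftrightarrow>
     (\<forall>i\<in>{0,1,2::nat}. let l = [l0, l1, l2] ! i in
        (l = None \<longrightarrow> {e\<in>E. anchoring pos k X e = i} = {}) \<and>
        (\<forall>m. l = Some m \<longrightarrow> (\<forall>e\<in>E. anchoring pos k X e = i \<longrightarrow> crossing_number c k X e \<le> m)))"

definition line_curve :: "pt \<times> pt \<Rightarrow> real \<Rightarrow> pt" where
  "line_curve L t = fst L + t *\<^sub>R snd L"

definition seg :: "(nat \<Rightarrow> pt) \<Rightarrow> nat \<times> nat \<Rightarrow> real \<Rightarrow> pt" where
  "seg p e = linepath (p (fst e)) (p (snd e))"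

definition path_meets_before :: "(real \<Rightarrow> pt) \<Rightarrow> pt set \<Rightarrow> pt set \<Rightarrow> bool" where
  "path_meets_before \<gamma> S T \<longleftrightarrow> (\<exists>s t. 0 \<le> s \<and> s < t \<and> t \<le> 1 \<and> \<gamma> s \<in> S \<and> \<gamma> t \<in> T)"

definition curve_meets_before :: "(real \<Rightarrow> pt) \<Rightarrow> pt set \<Rightarrow> pt set \<Rightarrow> bool" where
  "curve_meets_before l S T \<longleftrightarrow> (\<exists>s t. s < t \<and> l s \<in> S \<and> l t \<in> T)"

definition obj :: "(nat \<Rightarrow> pt) \<Rightarrow> (nat \<times> nat \<Rightarrow> real \<Rightarrow> pt) \<Rightarrow> nat + (nat \<times> nat) \<Rightarrow> pt set" where
  "obj pos c x = (case x of Inl v \<Rightarrow> {pos v} | Inr e \<Rightarrow> path_image (c e))"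

definition graph_objects :: "nat set \<Rightarrow> (nat \<times> nat) set \<Rightarrow> (nat + (nat \<times> nat)) set" where
  "graph_objects V E = Inl ` V \<union> Inr ` E"

text \<open>Aligned drawing (conditions (i)-(v)): straight-line drawing p of G with lines L i.
(i) a plane homeomorphism g carries the pseudoline arrangement onto the line arrangement
(inducing the cell bijection C \<mapsto> g ` C); (ii) a plane homeomorphism f carries the given
embedding onto the straight-line drawing; (iii) cell incidences; (iv) cell order along
edges; (v) incidences and order along each (pseudo)line.\<close>

definition aligned_drawing ::
  "nat set \<Rightarrow> (nat \<times> nat) set \<Rightarrow> (nat \<Rightarrow> pt) \<Rightarrow> (nat \<times> nat \<Rightarrow> real \<Rightarrow> pt) \<Rightarrow> nat \<Rightarrow> (nat \<Rightarrow> real \<Rightarrow> pt)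
     \<Rightarrow> (nat \<Rightarrow> pt) \<Rightarrow> (nat \<Rightarrow> pt \<times> pt) \<Rightarrow> bool" where
  "aligned_drawing V E pos c k X p L \<longleftrightarrow>
     plane_drawing V E p (seg p) \<and>
     (\<forall>i<k. snd (L i) \<noteq> 0) \<and>
     (\<exists>f f'. homeomorphism UNIV UNIV f f' \<and> (\<forall>v\<in>V. f (pos v) = p v) \<and>
        (\<forall>e\<in>E. f ` path_image (c e) = path_image (seg p e))) \<and>
     (\<exists>g g'. homeomorphism UNIV UNIV g g' \<and>
        (\<forall>i<k. g ` range (X i) = range (line_curve (L i))) \<and>
        (let cells = components (- (\<Union>i<k. range (X i))) in
          (\<forall>C\<in>cells. \<forall>v\<in>V. pos v \<in> C \<longleftrightarrow> p v \<in> g ` C) \<and>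
          (\<forall>C\<in>cells. \<forall>e\<in>E. path_image (c e) \<inter> C \<noteq> {} \<longleftrightarrow> path_image (seg p e) \<inter> g ` C \<noteq> {}) \<and>
          (\<forall>e\<in>E. \<forall>C\<in>cells. \<forall>C'\<in>cells.
             path_meets_before (c e) C C' \<longleftrightarrow> path_meets_before (seg p e) (g ` C) (g ` C')))) \<and>
     (\<forall>i<k. \<forall>x\<in>graph_objects V E. \<forall>y\<in>graph_objects V E.
        (range (X i) \<inter> obj pos c x \<noteq> {} \<longleftrightarrow> range (line_curve (L i)) \<inter> obj p (seg p) x \<noteq> {}) \<and>
        (curve_meets_before (X i) (obj pos c x) (obj pos c y) \<longleftrightarrow>
         curve_meets_before (line_curve (L i)) (obj p (seg p) x) (obj p (seg p) y)))"

end

theory Submission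
  imports Defs
begin

text \<open>The pseudolines are the coordinate axes, and the graph consists of four disjoint paths with
two edges, drawn as the four rotated copies of a spiral arm that winds three quarters around the
origin.  Let \<open>u\<^sub>q\<close> be the middle vertex of arm \<open>q\<close>, which lies between the rays \<open>q\<close> and \<open>q + 1\<close>,
and let \<open>a\<^sub>q\<close> be its inner end on ray \<open>q - 1\<close>.  In a straight-line drawing write \<open>y\<^sub>q\<close>, \<open>x\<^sub>q\<close> for
the coordinates of \<open>u\<^sub>q\<close> along the rays \<open>q\<close>, \<open>q + 1\<close> and \<open>m\<^sub>q\<close> for the distance of \<open>a\<^sub>q\<close> from the
origin.  The edge \<open>a\<^sub>q u\<^sub>q\<close> crosses ray \<open>q\<close> beyond \<open>a\<^bsub>q+1\<^esub>\<close>, so \<open>m\<^bsub>q+1\<^esub> x\<^sub>q < m\<^sub>q y\<^sub>q\<close>.  It crosses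
below the outer edge of arm \<open>q - 1\<close>, so \<open>u\<^sub>q\<close> is trapped in the triangle which that edge cuts off
from the quadrant, whence \<open>y\<^sub>q < x\<^bsub>q-1\<^esub>\<close>.  Therefore \<open>m\<^bsub>q+1\<^esub> x\<^sub>q < m\<^sub>q x\<^bsub>q-1\<^esub>\<close> for all \<open>q\<close> modulo
4, which is absurd.\<close>

section \<open>Affine functionals\<close>

definition affine_functional :: "('a::real_normed_vector \<Rightarrow> real) \<Rightarrow> bool" where
  "affine_functional F \<longleftrightarrow> (\<forall>x y t. F (linepath x y t) = (1 - t) * F x + t * F y)"

lemma affine_functional_linepath:
  "affine_functional F \<Longrightarrow> F (linepath x y t) = (1 - t) * F x + t * F y"
  by (simp add: affine_functional_def)

lemma affine_functional_cmult: "affine_functional F \<Longrightarrow> affine_functional (\<lambda>x. r * F x)"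
  by (simp add: affine_functional_def distrib_left mult.left_commute)

lemma affine_functional_uminus: "affine_functional F \<Longrightarrow> affine_functional (\<lambda>x. - F x)"
  by (simp add: affine_functional_def)

lemma closed_segment_linepathE:
  assumes "z \<in> closed_segment x y"
  obtains t where "0 \<le> t" "t \<le> 1" "z = linepath x y t"
  using assms by (auto simp: in_segment linepath_def)

lemma affine_functional_nonneg_on_segment:
  assumes affine_F: "affine_functional F" and "0 \<le> F x" "0 \<le> F y" and z: "z \<in> closed_segment x y"
  shows "0 \<le> F z"
  using z by (rule closed_segment_linepathE)
    (simp add: affine_functional_linepath[OF affine_F] assms)

lemma affine_functional_attains:
  assumes affine_F: "affine_functional F" and "F x \<le> r" "r \<le> F y"
  obtains z where "z \<in> closed_segment x y" "F z = r"
proof (cases "F x = F y")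
  case True
  then show ?thesis using that[of x] assms by simp
next
  case False
  define t where "t = (r - F x) / (F y - F x)"
  have "t \<in> {0..1}" using assms False by (auto simp: t_def field_simps)
  moreover have "t * (F y - F x) = r - F x" using False by (simp add: t_def)
  then have "F (linepath x y t) = r"
    by (simp add: affine_functional_linepath[OF affine_F] algebra_simps)
  ultimately show ?thesis using that linepath_in_path by blast
qed

lemma affine_functional_neg_at_start:
  assumes affine_F: "affine_functional F"
    and st: "0 \<le> s" "s < t" "F (linepath x y s) < 0" "0 < F (linepath x y t)"
  shows "F x < 0"
proof -
  have "(1 - s) * F x + s * F y < 0" and "0 < (1 - t) * F x + t * F y"
    using st by (simp_all add: affine_functional_linepath[OF affine_F])
  then have "t * ((1 - s) * F x + s * F y) < 0" and "0 \<le> s * ((1 - t) * F x + t * F y)"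
    using st by (simp_all add: mult_pos_neg)
  then have "(t - s) * F x < 0" by (simp add: algebra_simps)
  then show ?thesis using st by (simp add: mult_less_0_iff)
qed

text \<open>Similar triangles: \<open>F x / F u = - G a / (G u - G a)\<close>.\<close>

lemma affine_functional_at_crossing:
  assumes affine_F: "affine_functional F" and affine_G: "affine_functional G"
    and "F a = 0" "G x = 0" and x: "x \<in> closed_segment a u"
  shows "F x * (G u - G a) = - G a * F u"
proof -
  obtain t where t: "x = linepath a u t" using x by (rule closed_segment_linepathE)
  have Fx: "F x = t * F u" and "(1 - t) * G a + t * G u = 0"
    using assms(3,4)
    by (simp_all add: t affine_functional_linepath[OF affine_F]
        affine_functional_linepath[OF affine_G])
  then have "t * (G u - G a) = - G a" by (simp add: algebra_simps)
  then show ?thesis using Fx by (metis mult.assoc mult.commute)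
qed

lemma in_hypotenuse_segment:
  assumes affine_F: "affine_functional F" and affine_G: "affine_functional G"
    and inj: "inj (\<lambda>x. (F x, G x))"
    and at_b: "F b = 0" "0 < G b" and at_c: "G c = 0" "0 < F c"
    and at_x: "0 \<le> F x" "0 \<le> G x" "F x / F c + G x / G b = 1"
  shows "x \<in> closed_segment b c"
proof -
  define t where "t = F x / F c"
  have Gx: "G x / G b = 1 - t" using at_x(3) by (simp add: t_def)
  moreover have "0 \<le> G x / G b" using at_x at_b by simp
  ultimately have "t \<le> 1" by linarith
  have "0 \<le> t" using at_x at_c by (simp add: t_def)
  have "F (linepath b c t) = F x"
    using at_b at_c by (simp add: affine_functional_linepath[OF affine_F] t_def)
  moreover have "G (linepath b c t) = G x"
    using at_b at_c Gx by (simp add: affine_functional_linepath[OF affine_G] field_simps)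
  ultimately have "linepath b c t = x" using injD[OF inj] by simp
  then show ?thesis using linepath_in_path[of t b c] \<open>0 \<le> t\<close> \<open>t \<le> 1\<close> by simp
qed

text \<open>The segment \<open>b c\<close> cuts off a triangle at the origin from the quadrant \<open>F, G > 0\<close>, which the
segment \<open>x u\<close> enters through the axis \<open>G = 0\<close> and cannot leave.\<close>

lemma trapped_by_hypotenuse:
  assumes affine_F: "affine_functional F" and affine_G: "affine_functional G"
    and inj: "inj (\<lambda>x. (F x, G x))"
    and at_b: "F b = 0" "0 < G b" and at_c: "G c = 0"
    and at_x: "G x = 0" "0 < F x" "F x < F c" and at_u: "0 < F u" "0 < G u"
    and disjoint: "closed_segment x u \<inter> closed_segment b c = {}"
  shows "F u < F c"
proof (rule ccontr)
  assume "\<not> F u < F c"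
  define l where "l = (\<lambda>y. F y / F c + G y / G b)"
  have "affine_functional l"
    using affine_F affine_G
    by (simp add: affine_functional_def l_def add_divide_distrib distrib_left)
  moreover have "l x \<le> 1" using at_x by (simp add: l_def)
  moreover have "1 \<le> F u / F c" "0 \<le> G u / G b" using \<open>\<not> F u < F c\<close> at_x at_u at_b by simp_all
  then have "1 \<le> l u" by (simp add: l_def)
  ultimately obtain z where z: "z \<in> closed_segment x u" "l z = 1"
    using affine_functional_attains by blast
  have "0 \<le> F z" "0 \<le> G z"
    using at_x at_u z affine_functional_nonneg_on_segment[OF affine_F, of x u z]
      affine_functional_nonneg_on_segment[OF affine_G, of x u z] by simp_all
  then have "z \<in> closed_segment b c"
    using in_hypotenuse_segment[OF affine_F affine_G inj at_b at_c] at_x z(2) by (simp add: l_def)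
  then show False using z(1) disjoint by blast
qed

lemma crossing_slope_bound:
  assumes affine_F: "affine_functional F" and affine_G: "affine_functional G"
    and at_a: "F a = 0" "G a < 0" and at_u: "0 < G u" and x: "x \<in> closed_segment a u" "G x = 0"
    and r_bounds: "0 < r" "r < F x"
  shows "r * G u < - G a * F u"
proof -
  have "r * G u < r * (G u - G a)" using r_bounds at_a by simp
  also have "\<dots> < F x * (G u - G a)" using r_bounds at_a at_u by simp
  also have "\<dots> = - G a * F u"
    using affine_functional_at_crossing[OF affine_F affine_G] at_a x by blast
  finally show ?thesis .
qed

lemma quadrant_edge_trapped:
  assumes affine_F: "affine_functional F" and affine_G: "affine_functional G"
    and inj: "inj (\<lambda>x. (F x, G x))"
    and at_a: "F a = 0" "G a < 0" and at_u: "0 < F u" "0 < G u"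
    and at_b: "F b = 0" "0 < G b" and at_v: "0 < F v"
    and x: "x \<in> closed_segment a u" "G x = 0" and y: "y \<in> closed_segment b v" "G y = 0"
    and "F x < F y" and disjoint: "closed_segment a u \<inter> closed_segment b v = {}"
  shows "F u < F v"
proof -
  have "F x * (G u - G a) = - G a * F u"
    by (rule affine_functional_at_crossing) fact+
  moreover have "0 < - G a * F u" using at_a at_u by (simp add: mult_neg_pos)
  ultimately have "0 < F x * (G u - G a)" by simp
  then have "0 < F x" using at_a at_u by (simp add: zero_less_mult_iff)
  have "closed_segment x u \<subseteq> closed_segment a u" "closed_segment b y \<subseteq> closed_segment b v"
    using x y by (simp_all add: subset_closed_segment)
  then have "closed_segment x u \<inter> closed_segment b y = {}" using disjoint by blast
  then have "F u < F y"
    using trapped_by_hypotenuse[OF affine_F affine_G inj at_b _ _ \<open>0 < F x\<close> \<open>F x < F y\<close> at_u] x y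
    by blast
  also have "F y \<le> F v"
    using y(1) by (rule closed_segment_linepathE)
      (use at_b at_v in \<open>simp add: affine_functional_linepath[OF affine_F] mult_left_le_one_le\<close>)
  finally show ?thesis .
qed

section \<open>Lines in the plane\<close>

definition line_functional :: "pt \<times> pt \<Rightarrow> pt \<Rightarrow> real" where
  "line_functional L p = (p $ 1 - fst L $ 1) * snd L $ 2 - (p $ 2 - fst L $ 2) * snd L $ 1"

lemma affine_line_functional: "affine_functional (line_functional L)"
  by (simp add: affine_functional_def linepath_def line_functional_def algebra_simps)

lemma continuous_on_line_functional: "continuous_on S (line_functional L)"
  unfolding line_functional_def by (intro continuous_intros)

lemma pt_eq_iff: "(x::pt) = y \<longleftrightarrow> x $ 1 = y $ 1 \<and> x $ 2 = y $ 2"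
  by (simp add: vec_eq_iff forall_2)

lemma line_functional_eq_0_iff:
  assumes "snd L \<noteq> 0"
  shows "line_functional L p = 0 \<longleftrightarrow> p \<in> range (line_curve L)"
proof
  assume zero: "line_functional L p = 0"
  show "p \<in> range (line_curve L)"
  proof (cases "snd L $ 1 = 0")
    case True
    then have "snd L $ 2 \<noteq> 0" using assms by (simp add: pt_eq_iff)
    then have "p = line_curve L ((p $ 2 - fst L $ 2) / snd L $ 2)"
      using zero True by (simp add: pt_eq_iff line_curve_def line_functional_def)
    then show ?thesis by blast
  next
    case False
    then have "p = line_curve L ((p $ 1 - fst L $ 1) / snd L $ 1)"
      using zero by (simp add: pt_eq_iff line_curve_def line_functional_def field_simps)
    then show ?thesis by blast
  qed
qed (auto simp: line_curve_def line_functional_def)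

lemma line_functional_attains_signs:
  assumes "snd L \<noteq> 0"
  obtains x y where "0 < line_functional L x" "line_functional L y < 0"
proof -
  define n :: pt where "n = vector [snd L $ 2, - snd L $ 1]"
  have "line_functional L (fst L + n) = snd L \<bullet> snd L"
    "line_functional L (fst L - n) = - (snd L \<bullet> snd L)"
    by (simp_all add: line_functional_def n_def inner_vec_def sum_2 algebra_simps)
  moreover have "0 < snd L \<bullet> snd L" using assms by simp
  ultimately show ?thesis using that[of "fst L + n" "fst L - n"] by simp
qed

lemma inj_line_functional_pair:
  assumes meet: "range (line_curve L) \<inter> range (line_curve M) = {z}"
    and dir_L: "snd L \<noteq> 0" and dir_M: "snd M \<noteq> 0"
  shows "inj (\<lambda>x. (line_functional L x, line_functional M x))"
proof (rule injI)
  define d where "d = snd L $ 1 * snd M $ 2 - snd L $ 2 * snd M $ 1"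
  have "d \<noteq> 0"
  proof
    assume "d = 0"
    have "z \<in> range (line_curve L)" and zM: "z \<in> range (line_curve M)" using meet by auto
    then obtain s where "z = line_curve L s" by blast
    then have "z + snd L = line_curve L (s + 1)" by (simp add: line_curve_def algebra_simps)
    moreover have "line_functional M (z + snd L) = line_functional M z + d"
      by (simp add: line_functional_def d_def algebra_simps)
    then have "z + snd L \<in> range (line_curve M)"
      using zM \<open>d = 0\<close> by (simp flip: line_functional_eq_0_iff[OF dir_M])
    ultimately have "z + snd L = z" using meet by blast
    then show False using dir_L by simp
  qed
  fix x y
  assume "(line_functional L x, line_functional M x) = (line_functional L y, line_functional M y)"
  then have "d * (x $ 1 - y $ 1) = 0" "d * (x $ 2 - y $ 2) = 0"
    by (simp_all add: d_def line_functional_def) algebra+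
  then show "x = y" using \<open>d \<noteq> 0\<close> by (simp add: pt_eq_iff)
qed

lemma affine_functional_line_curve:
  assumes "affine_functional F"
  shows "F (line_curve L t) = F (line_curve L 0) + t * (F (line_curve L 1) - F (line_curve L 0))"
proof -
  have "line_curve L t = linepath (line_curve L 0) (line_curve L 1) t"
    by (simp add: line_curve_def linepath_def algebra_simps)
  then have "F (line_curve L t) = (1 - t) * F (line_curve L 0) + t * F (line_curve L 1)"
    by (simp add: affine_functional_linepath[OF assms])
  then show ?thesis by (simp add: algebra_simps)
qed

lemma affine_functional_increasing_along_line:
  assumes affine_F: "affine_functional F"
    and xy: "curve_meets_before (line_curve L) {x} {y}" "F x < F y"
    and ST: "curve_meets_before (line_curve L) S T"
  obtains x' y' where "x' \<in> S \<inter> range (line_curve L)" "y' \<in> T \<inter> range (line_curve L)" "F x' < F y'"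
proof -
  define k where "k = F (line_curve L 1) - F (line_curve L 0)"
  have F_line: "F (line_curve L t) = F (line_curve L 0) + t * k" for t
    unfolding k_def by (rule affine_functional_line_curve[OF affine_F])
  obtain s t where st: "s < t" "line_curve L s = x" "line_curve L t = y"
    using xy(1) by (auto simp: curve_meets_before_def)
  then have "0 < (t - s) * k" using xy(2) F_line[of s] F_line[of t] by (simp add: algebra_simps)
  then have "0 < k" using st(1) by (simp add: zero_less_mult_iff)
  obtain s' t' where "s' < t'" "line_curve L s' \<in> S" "line_curve L t' \<in> T"
    using ST by (auto simp: curve_meets_before_def)
  moreover from this \<open>0 < k\<close> have "F (line_curve L s') < F (line_curve L t')"
    by (simp add: F_line[of s'] F_line[of t'])
  ultimately show ?thesis using that by blast
qed

section \<open>Sign regions of continuous functions\<close>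

lemma connected_nonzero_same_sign:
  fixes f :: "'a::topological_space \<Rightarrow> real"
  assumes "connected S" "continuous_on S f" "\<And>x. x \<in> S \<Longrightarrow> f x \<noteq> 0" "x \<in> S" "y \<in> S"
  shows "0 < f x \<longleftrightarrow> 0 < f y"
proof (rule ccontr)
  assume "(0 < f x) \<noteq> (0 < f y)"
  then have "f x \<le> 0 \<and> 0 \<le> f y \<or> f y \<le> 0 \<and> 0 \<le> f x" by linarith
  moreover have "connected (f ` S)" using assms connected_continuous_image by blast
  ultimately have "0 \<in> f ` S" using assms(4,5) by (metis connectedD_interval imageI)
  then show False using assms(3) by auto
qed

lemma positive_region_in_components:
  fixes f h :: "'a::topological_space \<Rightarrow> real"
  assumes cont: "continuous_on UNIV f" "continuous_on UNIV h"
    and conn: "connected {x. 0 < f x \<and> 0 < h x}" and x0: "0 < f x0" "0 < h x0"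
  shows "{x. 0 < f x \<and> 0 < h x} \<in> components {x. f x \<noteq> 0 \<and> h x \<noteq> 0}"
  unfolding in_components_maximal
proof (intro conjI allI impI)
  show "{x. 0 < f x \<and> 0 < h x} \<noteq> {}" using x0 by blast
  fix D
  assume connected_superset: "D \<noteq> {} \<and> {x. 0 < f x \<and> 0 < h x} \<subseteq> D \<and>
    D \<subseteq> {x. f x \<noteq> 0 \<and> h x \<noteq> 0} \<and> connected D"
  then have "continuous_on D f" "continuous_on D h" "x0 \<in> D"
    using cont x0 continuous_on_subset by blast+
  then have "0 < f x \<and> 0 < h x" if "x \<in> D" for x
    using that connected_superset x0
      connected_nonzero_same_sign[of D f x0 x]
      connected_nonzero_same_sign[of D h x0 x]
    by blast
  then show "D = {x. 0 < f x \<and> 0 < h x}" using connected_superset by blast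
qed (use conn in auto)

lemma continuous_sign_transfer:
  fixes f :: "'a::topological_space \<Rightarrow> real" and h :: "'b::topological_space \<Rightarrow> real"
  assumes cont: "continuous_on UNIV g" "continuous_on UNIV h" and "surj g"
    and zero_iff: "\<And>x. h (g x) = 0 \<longleftrightarrow> f x = 0"
    and conn: "connected {x. 0 < f x}" "connected {x. f x < 0}"
    and signs: "0 < h y" "h z < 0"
  obtains s where "s \<noteq> 0" "\<And>x. sgn (s * h (g x)) = sgn (f x)"
proof -
  have cont_hg: "continuous_on S (h \<circ> g)" for S
    using cont by (meson continuous_on_compose continuous_on_subset subset_UNIV)
  have pos_region: "0 < h (g x) \<longleftrightarrow> 0 < h (g x')" if "0 < f x" "0 < f x'" for x x'
    using connected_nonzero_same_sign[OF conn(1) cont_hg, of x x'] that zero_iff by auto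
  have neg_region: "0 < h (g x) \<longleftrightarrow> 0 < h (g x')" if "f x < 0" "f x' < 0" for x x'
    using connected_nonzero_same_sign[OF conn(2) cont_hg, of x x'] that zero_iff by auto
  obtain y' z' where "g y' = y" "g z' = z" using \<open>surj g\<close> by (metis surjD)
  then have yz: "0 < h (g y')" "h (g z') < 0" using signs by simp_all
  then have "f y' \<noteq> 0" "f z' \<noteq> 0" using zero_iff by (metis less_irrefl)+
  show ?thesis
  proof (cases "0 < f y'")
    case True
    then have "f z' < 0" using pos_region[of y' z'] yz \<open>f z' \<noteq> 0\<close> by linarith
    have "sgn (1 * h (g x)) = sgn (f x)" for x
      using True \<open>f z' < 0\<close> yz zero_iff[of x] pos_region[of x y'] neg_region[of x z']
      by (auto simp: sgn_if)
    then show ?thesis using that[of 1] by simp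
  next
    case False
    then have "f y' < 0" using \<open>f y' \<noteq> 0\<close> by simp
    then have "0 < f z'" using neg_region[of y' z'] yz \<open>f z' \<noteq> 0\<close> by linarith
    have "sgn (-1 * h (g x)) = sgn (f x)" for x
      using \<open>f y' < 0\<close> \<open>0 < f z'\<close> yz zero_iff[of x] pos_region[of x z'] neg_region[of x y']
      by (auto simp: sgn_if)
    then show ?thesis using that[of "-1"] by simp
  qed
qed

lemma crosses_at_zero_setI:
  fixes f :: "pt \<Rightarrow> real"
  assumes zero_set: "range l = {x. f x = 0}" and cont: "continuous_on UNIV f" and "0 < \<epsilon>"
    and opposite: "\<And>a b. t - \<epsilon> < a \<Longrightarrow> a < t \<Longrightarrow> t < b \<Longrightarrow> b < t + \<epsilon> \<Longrightarrow> f (\<gamma> a) * f (\<gamma> b) < 0"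
  shows "crosses_at l \<gamma> t"
  unfolding crosses_at_def
proof (intro exI[of _ \<epsilon>] conjI allI impI)
  fix a b assume "t - \<epsilon> < a \<and> a < t \<and> t < b \<and> b < t + \<epsilon>"
  then have opp: "f (\<gamma> a) * f (\<gamma> b) < 0" using opposite by blast
  then show "\<gamma> a \<notin> range l" "\<gamma> b \<notin> range l" unfolding zero_set by auto
  show "\<not> connected_component (- range l) (\<gamma> a) (\<gamma> b)"
  proof
    assume "connected_component (- range l) (\<gamma> a) (\<gamma> b)"
    then obtain S where S: "connected S" "S \<subseteq> - range l" "\<gamma> a \<in> S" "\<gamma> b \<in> S"
      by (auto simp: connected_component_def)
    then have "0 < f (\<gamma> a) \<longleftrightarrow> 0 < f (\<gamma> b)"
      using continuous_on_subset[OF cont]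
      by (intro connected_nonzero_same_sign[of S]) (auto simp: zero_set)
    then show False using opp by (auto simp: mult_less_0_iff)
  qed
qed fact

section \<open>Quarter turns\<close>

definition dir :: "real \<Rightarrow> pt" where
  "dir \<theta> = vector [cos (\<theta> * pi / 2), sin (\<theta> * pi / 2)]"

definition proj :: "real \<Rightarrow> pt \<Rightarrow> real" where
  "proj \<theta> p = dir \<theta> \<bullet> p"

lemma dir_nth [simp]: "dir \<theta> $ 1 = cos (\<theta> * pi / 2)" "dir \<theta> $ 2 = sin (\<theta> * pi / 2)"
  by (simp_all add: dir_def)

lemma norm_dir [simp]: "norm (dir \<theta>) = 1"
  by (simp add: norm_vec_def L2_set_def sum_2)

lemma continuous_on_dir: "continuous_on S dir"
proof -
  have dir_eq: "dir = (\<lambda>\<theta>. cos (\<theta> * pi / 2) *\<^sub>R axis 1 1 + sin (\<theta> * pi / 2) *\<^sub>R axis 2 1)"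
    by (simp add: fun_eq_iff pt_eq_iff axis_def)
  show ?thesis unfolding dir_eq by (intro continuous_intros) simp_all
qed

lemma dir_add_2: "dir (\<theta> + 2) = - dir \<theta>"
  by (simp add: pt_eq_iff distrib_right add_divide_distrib cos_add sin_add)

lemma dir_add_4_mult: "dir (\<theta> + 4 * real n) = dir \<theta>"
proof (induction n)
  case (Suc n)
  have "dir (\<theta> + 4 * real (Suc n)) = dir (\<theta> + 4 * real n + 2 + 2)" by (simp add: algebra_simps)
  then show ?case using Suc by (simp only: dir_add_2 minus_minus)
qed simp

lemma dir_eq_dirD:
  assumes "dir \<theta> = dir \<phi>" shows "\<exists>n::int. \<theta> - \<phi> = 4 * of_int n"
proof -
  have "sin (\<theta> * pi / 2) = sin (\<phi> * pi / 2) \<and> cos (\<theta> * pi / 2) = cos (\<phi> * pi / 2)"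
    using assms by (simp add: pt_eq_iff)
  then obtain n :: int where "\<theta> * pi / 2 = \<phi> * pi / 2 + 2 * pi * of_int n"
    using sin_cos_eq_iff by blast
  then have "pi * (\<theta> - \<phi>) = pi * (4 * of_int n)" by (simp add: algebra_simps)
  then show ?thesis by (metis mult_cancel_left pi_neq_zero)
qed

lemma proj_scaleR_dir: "proj \<theta> (r *\<^sub>R dir \<phi>) = r * cos ((\<phi> - \<theta>) * pi / 2)"
  by (simp add: proj_def inner_vec_def sum_2 cos_diff left_diff_distrib diff_divide_distrib
      algebra_simps)

lemma proj_Suc_scaleR_dir: "proj (\<theta> + 1) (r *\<^sub>R dir \<phi>) = r * sin ((\<phi> - \<theta>) * pi / 2)"
proof -
  have "(\<phi> - (\<theta> + 1)) * pi / 2 = (\<phi> - \<theta>) * pi / 2 - pi / 2" by (simp add: field_simps)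
  then show ?thesis by (simp only: proj_scaleR_dir cos_diff cos_pi_half sin_pi_half) simp
qed

lemma proj_add_2: "proj (\<theta> + 2) p = - proj \<theta> p"
  by (simp add: proj_def dir_add_2)

lemma continuous_on_proj: "continuous_on S (proj \<theta>)"
  unfolding proj_def by (intro continuous_intros)

lemma proj_expand: "p = proj \<theta> p *\<^sub>R dir \<theta> + proj (\<theta> + 1) p *\<^sub>R dir (\<theta> + 1)"
proof -
  define C S where "C = cos (\<theta> * pi / 2)" and "S = sin (\<theta> * pi / 2)"
  have "C\<^sup>2 + S\<^sup>2 = 1" by (simp add: C_def S_def)
  then have "x = (C * x + S * y) * C - (C * y - S * x) * S"
    "y = (C * x + S * y) * S + (C * y - S * x) * C" for x y
    by algebra+
  moreover have "dir (\<theta> + 1) $ 1 = - S" "dir (\<theta> + 1) $ 2 = C" "dir \<theta> $ 1 = C" "dir \<theta> $ 2 = S"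
    by (simp_all add: C_def S_def distrib_right add_divide_distrib cos_add sin_add)
  ultimately show ?thesis
    by (simp add: pt_eq_iff proj_def inner_vec_def sum_2 del: dir_nth)
qed

lemma sgn_sin_quarter_turns:
  assumes "\<bar>\<delta>\<bar> < 2" shows "sgn (sin (\<delta> * pi / 2)) = sgn \<delta>"
proof -
  have sin_pos: "0 < sin (t * pi / 2)" if "0 < t" "t < 2" for t
    using that by (intro sin_gt_zero) simp_all
  show ?thesis
    using assms sin_pos[of \<delta>] sin_pos[of "- \<delta>"]
    by (cases \<delta> "0::real" rule: linorder_cases) simp_all
qed

section \<open>Spokes and sectors\<close>

definition spoke :: "nat \<Rightarrow> real \<Rightarrow> pt" where
  "spoke i t = t *\<^sub>R dir (real i)"

lemma norm_spoke: "norm (spoke i t) = \<bar>t\<bar>"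
  by (simp add: spoke_def)

lemma range_spoke: "range (spoke i) = {p. proj (real i + 1) p = 0}"
proof safe
  fix t show "proj (real i + 1) (spoke i t) = 0"
    by (simp add: spoke_def proj_Suc_scaleR_dir)
next
  fix p assume "proj (real i + 1) p = 0"
  then have "p = spoke i (proj i p)" using proj_expand[of p "real i"] by (simp add: spoke_def)
  then show "p \<in> range (spoke i)" by blast
qed

lemma range_spoke_add_2: "range (spoke (i + 2)) = range (spoke i)"
  using proj_add_2[of "real i + 1"] by (simp add: range_spoke add_ac)

lemma spokes_Un: "(\<Union>i<2. range (spoke i)) = range (spoke k) \<union> range (spoke (k + 1))"
proof (induction k)
  case (Suc k)
  then show ?case using range_spoke_add_2[of k] by auto
qed (auto simp: less_2_cases_iff)

lemma spokes_Int:
  assumes "i < 2" "j < 2" "i \<noteq> j"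
  shows "range (spoke i) \<inter> range (spoke j) = {0}"
proof -
  have "p = 0" if "proj 1 p = 0" "proj 2 p = 0" for p
    using that proj_expand[of p 1] by simp
  then have "range (spoke 0) \<inter> range (spoke 1) = {0}"
    by (auto simp: range_spoke) (simp_all add: proj_def)
  then show ?thesis using assms by (auto simp: less_2_cases_iff)
qed

lemma scaleR_dir_eq_spoke: "r *\<^sub>R dir (real q) = spoke (q mod 2) ((-1) ^ (q div 2) * r)"
proof (induction q rule: nat_induct2)
  case (step q)
  then show ?case using dir_add_2[of "real q"] by (simp add: spoke_def add.commute)
qed (simp_all add: spoke_def)

lemma scaleR_dir_in_spoke: "r *\<^sub>R dir (real q) \<in> range (spoke (q mod 2))"
  by (simp add: scaleR_dir_eq_spoke)

definition sector :: "(nat \<Rightarrow> 'a \<Rightarrow> real) \<Rightarrow> nat \<Rightarrow> 'a set" where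
  "sector F k = {x. 0 < F k x \<and> 0 < F (k + 1) x}"

definition quadrant :: "nat \<Rightarrow> pt set" where
  "quadrant = sector (\<lambda>q. proj (real q))"

lemma quadrant_eq: "quadrant k = {p. 0 < proj (real k) p \<and> 0 < proj (real k + 1) p}"
  by (simp add: quadrant_def sector_def add.commute)

lemma scaleR_dir_in_quadrant:
  assumes "0 < r" "real k < \<theta>" "\<theta> < real k + 1"
  shows "r *\<^sub>R dir \<theta> \<in> quadrant k"
proof -
  have "0 < (\<theta> - real k) * pi / 2" "(\<theta> - real k) * pi / 2 < pi / 2" using assms by simp_all
  then have "0 < cos ((\<theta> - real k) * pi / 2)" "0 < sin ((\<theta> - real k) * pi / 2)"
    by (auto intro!: cos_gt_zero sin_gt_zero2)
  then show ?thesis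
    using assms(1) by (simp add: quadrant_eq proj_Suc_scaleR_dir) (simp add: proj_scaleR_dir)
qed

lemma quadrant_in_components: "quadrant k \<in> components (- (\<Union>i<2. range (spoke i)))"
proof -
  have "range (spoke (k + 1)) = {p. proj (real k) p = 0}"
    using proj_add_2[of "real k"] by (simp add: range_spoke add_ac)
  then have complement:
    "- (\<Union>i<2. range (spoke i)) = {p. proj (real k) p \<noteq> 0 \<and> proj (real k + 1) p \<noteq> 0}"
    unfolding spokes_Un[of k] by (auto simp: range_spoke)
  have connected: "connected {p. 0 < proj (real k) p \<and> 0 < proj (real k + 1) p}"
    by (simp add: proj_def Collect_conj_eq convex_Int convex_connected convex_halfspace_gt)
  have "1 *\<^sub>R dir (real k + 1 / 2) \<in> quadrant k"
    by (rule scaleR_dir_in_quadrant) simp_all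
  then show ?thesis
    unfolding complement quadrant_eq mem_Collect_eq
    using positive_region_in_components[OF continuous_on_proj continuous_on_proj connected] by blast
qed

section \<open>Spiral arms\<close>

text \<open>An arc of an Archimedean spiral: for \<open>\<sigma>\<close> from -1 to 2 it starts on ray \<open>\<theta> - 1\<close> at distance 1
from the origin, crosses rays \<open>\<theta>\<close> and \<open>\<theta> + 1\<close> at distances 2 and 3, and ends on ray \<open>\<theta> + 2\<close> at
distance 4.\<close>

definition arm :: "real \<Rightarrow> real \<Rightarrow> pt" where
  "arm \<theta> \<sigma> = (2 + \<sigma>) *\<^sub>R dir (\<theta> + \<sigma>)"

lemma norm_arm: "-2 \<le> \<sigma> \<Longrightarrow> norm (arm \<theta> \<sigma>) = 2 + \<sigma>"
  by (simp add: arm_def)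

lemma continuous_on_arm: "continuous_on S (arm \<theta>)"
  unfolding arm_def
  by (intro continuous_intros continuous_on_compose2[OF continuous_on_dir[of UNIV]]) auto

lemma arm_mod_4: "arm (real (q mod 4)) = arm (real q)"
proof -
  have "real q = real (q mod 4) + 4 * real (q div 4)"
    by (metis mod_mult_div_eq of_nat_add of_nat_mult of_nat_numeral)
  then have "dir (real q + \<sigma>) = dir (real (q mod 4) + \<sigma> + 4 * real (q div 4))" for \<sigma>
    by (simp only: add_ac)
  then show ?thesis by (simp add: fun_eq_iff arm_def dir_add_4_mult)
qed

lemma arm_cong_mod_4: "q mod 4 = q' mod 4 \<Longrightarrow> arm (real q) = arm (real q')"
  by (metis arm_mod_4)

lemma arm_eq_armD:
  assumes "arm (real q) \<sigma> = arm (real q') \<sigma>'" "-2 < \<sigma>" "-2 < \<sigma>'"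
  shows "\<sigma> = \<sigma>'" "q mod 4 = q' mod 4"
proof -
  show "\<sigma> = \<sigma>'" using assms norm_arm[of \<sigma> "real q"] norm_arm[of \<sigma>' "real q'"] by simp
  then have "dir (real q + \<sigma>) = dir (real q' + \<sigma>)" using assms by (simp add: arm_def)
  then obtain n :: int where "real q - real q' = 4 * of_int n"
    using dir_eq_dirD[of "real q + \<sigma>" "real q' + \<sigma>"] by auto
  then have "of_int (int q - int q') = (of_int (4 * n) :: real)" by simp
  then have "int q - int q' = 4 * n" by (simp only: of_int_eq_iff)
  then show "q mod 4 = q' mod 4" by presburger
qed

lemma proj_arm: "proj (real i + 1) (arm \<theta> \<sigma>) = (2 + \<sigma>) * sin ((\<theta> + \<sigma> - real i) * pi / 2)"
  by (simp add: arm_def proj_Suc_scaleR_dir)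

lemma arm_in_spoke_iff:
  assumes "-2 < \<sigma>"
  shows "arm (real q) \<sigma> \<in> range (spoke i) \<longleftrightarrow> (\<exists>n::int. real q + \<sigma> = real i + 2 * of_int n)"
proof -
  have half_turns: "r * pi / 2 = of_int n * pi \<longleftrightarrow> r = 2 * of_int n" for r and n :: int
    by (auto simp: field_simps)
  have "arm (real q) \<sigma> \<in> range (spoke i) \<longleftrightarrow>
      (\<exists>n::int. (real q + \<sigma> - real i) * pi / 2 = of_int n * pi)"
    using assms by (simp add: range_spoke proj_arm sin_zero_iff_int2)
  also have "\<dots> \<longleftrightarrow> (\<exists>n::int. real q + \<sigma> = real i + 2 * of_int n)"
    using half_turns[of "real q + \<sigma> - real i"] by (simp add: algebra_simps)
  finally show ?thesis .
qed

lemma arm_in_spoke_unique: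
  assumes "-2 < \<sigma>" "i < 2" "j < 2"
    and "arm \<theta> \<sigma> \<in> range (spoke i)" "arm \<theta> \<sigma> \<in> range (spoke j)"
  shows "i = j"
proof (rule ccontr)
  assume "i \<noteq> j"
  then have "arm \<theta> \<sigma> = 0" using assms spokes_Int by blast
  then show False using norm_arm[of \<sigma> \<theta>] assms(1) by simp
qed

lemma on_pl_arm_iff:
  assumes "-2 < \<sigma>" shows "on_pl 2 spoke (arm (real q) \<sigma>) \<longleftrightarrow> \<sigma> \<in> \<int>"
proof
  assume "on_pl 2 spoke (arm (real q) \<sigma>)"
  then obtain i and n :: int where "real q + \<sigma> = real i + 2 * of_int n"
    using assms by (auto simp: on_pl_def arm_in_spoke_iff)
  then have "\<sigma> = of_int (int i + 2 * n - int q)" by simp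
  then show "\<sigma> \<in> \<int>" by (metis Ints_of_int)
next
  assume "\<sigma> \<in> \<int>"
  then obtain m where "\<sigma> = of_int m" by (rule Ints_cases)
  define i and n where "i = nat ((int q + m) mod 2)" and "n = (int q + m) div 2"
  have "int q + m = int i + 2 * n" by (simp add: i_def n_def)
  then have "real_of_int (int q + m) = real_of_int (int i + 2 * n)" by (simp only:)
  then have "real q + \<sigma> = real i + 2 * of_int n" using \<open>\<sigma> = of_int m\<close> by simp
  moreover have "i < 2" by (auto simp: i_def)
  ultimately show "on_pl 2 spoke (arm (real q) \<sigma>)"
    unfolding on_pl_def arm_in_spoke_iff[OF assms] by blast
qed

lemma spoke_crosses_arm:
  assumes "a \<noteq> b" "-1 \<le> linepath a b t" and on: "arm (real q) (linepath a b t) \<in> range (spoke i)"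
  shows "crosses_at (spoke i) (arm (real q) \<circ> linepath a b) t"
proof (rule crosses_at_zero_setI[OF range_spoke continuous_on_proj])
  show "0 < 1 / \<bar>b - a\<bar>" using \<open>a \<noteq> b\<close> by simp
  obtain n :: int where n: "real q + linepath a b t = real i + 2 * of_int n"
    using on arm_in_spoke_iff assms(2) by force
  have shift: "linepath a b s = linepath a b t + (b - a) * (s - t)" for s
    by (simp add: linepath_def algebra_simps)
  define f where "f s = proj (real i + 1) (arm (real q) (linepath a b s))" for s
  have f_eq:
    "f s = (2 + linepath a b s) * cos (pi * of_int n) * sin ((b - a) * (s - t) * pi / 2)" for s
  proof -
    have "real q + linepath a b s - real i = 2 * of_int n + (b - a) * (s - t)"
      using n shift[of s] by linarith
    then have "(real q + linepath a b s - real i) * pi / 2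
        = pi * of_int n + (b - a) * (s - t) * pi / 2"
      by (simp add: distrib_right add_divide_distrib)
    then show ?thesis by (simp only: f_def proj_arm sin_add sin_npi_int mult.assoc) simp
  qed
  have sgn_f: "sgn (f s) = sgn (cos (pi * of_int n)) * sgn (b - a) * sgn (s - t)"
    if "\<bar>s - t\<bar> < 1 / \<bar>b - a\<bar>" for s
  proof -
    have small: "\<bar>(b - a) * (s - t)\<bar> < 1"
      using that \<open>a \<noteq> b\<close> by (simp add: abs_mult pos_less_divide_eq mult.commute)
    then have "0 < 2 + linepath a b s" using assms(2) shift[of s] by linarith
    then show ?thesis using small by (simp add: f_eq sgn_mult sgn_sin_quarter_turns)
  qed
  fix x y assume "t - 1 / \<bar>b - a\<bar> < x" "x < t" "t < y" "y < t + 1 / \<bar>b - a\<bar>"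
  then have "sgn (f x * f y) = -1"
    using \<open>a \<noteq> b\<close> by (simp add: sgn_mult sgn_f)
  then show "proj (real i + 1) ((arm (real q) \<circ> linepath a b) x)
      * proj (real i + 1) ((arm (real q) \<circ> linepath a b) y) < 0"
    by (simp add: f_def sgn_1_neg)
qed

section \<open>The pinwheel graph\<close>

text \<open>The inner end, the outer end and the middle vertex of arm \<open>q\<close>, where arms are indexed by the
natural numbers modulo 4; \<open>knot\<close> gives the position of a vertex on its arm.\<close>

definition hub :: "nat \<Rightarrow> nat" where "hub q = q mod 4"

definition rim :: "nat \<Rightarrow> nat" where "rim q = 4 + q mod 4"

definition bend :: "nat \<Rightarrow> nat" where "bend q = 8 + q mod 4"

definition knot :: "nat \<Rightarrow> real" where
  "knot v = (if v < 4 then -1 else if v < 8 then 2 else 1 / 2)"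

definition pinwheel_V :: "nat set" where "pinwheel_V = {..<12}"

definition pinwheel_E :: "(nat \<times> nat) set" where "pinwheel_E = {(z, bend z) | z. z < 8}"

definition pinwheel_pos :: "nat \<Rightarrow> pt" where "pinwheel_pos v = arm (real v) (knot v)"

definition pinwheel_edge :: "nat \<times> nat \<Rightarrow> real \<Rightarrow> pt" where
  "pinwheel_edge e = arm (real (fst e)) \<circ> linepath (knot (fst e)) (knot (snd e))"

lemma knot_simps [simp]: "knot (hub q) = -1" "knot (rim q) = 2" "knot (bend q) = 1 / 2"
  by (simp_all add: knot_def hub_def rim_def bend_def)

lemma knot_bounds: "-1 \<le> knot v" "knot v \<le> 2"
  by (simp_all add: knot_def)

lemma pinwheel_vertices: "hub q \<in> pinwheel_V" "rim q \<in> pinwheel_V" "bend q \<in> pinwheel_V"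
  by (simp_all add: pinwheel_V_def hub_def rim_def bend_def)

lemma pinwheel_edges: "(hub q, bend q) \<in> pinwheel_E" "(rim q, bend q) \<in> pinwheel_E"
  by (auto simp: pinwheel_E_def hub_def rim_def bend_def)

lemma pinwheel_E_cases:
  assumes "e \<in> pinwheel_E"
  obtains z where "e = (z, bend z)" "z < 8" "knot z = -1 \<or> knot z = 2"
  using assms by (auto simp: pinwheel_E_def knot_def)

lemma arm_pinwheel [simp]:
  "arm (real (hub q)) = arm (real q)" "arm (real (rim q)) = arm (real q)"
  "arm (real (bend q)) = arm (real q)"
  by (rule arm_cong_mod_4, simp add: hub_def rim_def bend_def; presburger)+

lemma path_image_pinwheel_edge:
  "path_image (pinwheel_edge e) = arm (real (fst e)) ` closed_segment (knot (fst e)) (knot (snd e))"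
  by (simp add: pinwheel_edge_def path_image_compose)

lemma pinwheel_edge_interior:
  assumes "e \<in> pinwheel_E"
  shows "pinwheel_edge e ` {0<..<1} = arm (real (fst e)) ` open_segment (knot (fst e)) (1 / 2)"
  using assms
  by (rule pinwheel_E_cases)
    (auto simp: pinwheel_edge_def linepath_def image_comp[symmetric] open_segment_image_interval)

lemma closed_segment_knot_bounds: "\<sigma> \<in> closed_segment (knot v) (knot w) \<Longrightarrow> -1 \<le> \<sigma> \<and> \<sigma> \<le> 2"
  using knot_bounds[of v] knot_bounds[of w]
  by (auto simp: closed_segment_eq_real_ivl split: if_splits)

lemma arc_pinwheel_edge:
  assumes "knot (fst e) \<noteq> knot (snd e)" shows "arc (pinwheel_edge e)"
proof -
  let ?l = "linepath (knot (fst e)) (knot (snd e))"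
  have "path (pinwheel_edge e)"
    unfolding pinwheel_edge_def by (intro path_continuous_image path_linepath continuous_on_arm)
  moreover have "inj_on (arm (real (fst e))) (?l ` {0..1})"
  proof (rule inj_onI)
    fix \<sigma> \<tau>
    assume "\<sigma> \<in> ?l ` {0..1}" "\<tau> \<in> ?l ` {0..1}"
      and eq: "arm (real (fst e)) \<sigma> = arm (real (fst e)) \<tau>"
    then have "-1 \<le> \<sigma>" "-1 \<le> \<tau>"
      unfolding linepath_image_01 using closed_segment_knot_bounds by blast+
    then show "\<sigma> = \<tau>" using arm_eq_armD(1)[OF eq] by simp
  qed
  then have "inj_on (pinwheel_edge e) {0..1}"
    unfolding pinwheel_edge_def using assms by (intro comp_inj_on inj_on_linepath)
  ultimately show ?thesis by (simp add: arc_def)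
qed

lemma pinwheel_V_cases:
  assumes "v \<in> pinwheel_V"
  shows "v = hub v \<and> knot v = -1 \<or> v = rim v \<and> knot v = 2 \<or> v = bend v \<and> knot v = 1 / 2"
proof -
  have "v = 4 * (v div 4) + v mod 4" "v div 4 = 0 \<or> v div 4 = 1 \<or> v div 4 = 2" "v mod 4 < 4"
    using assms by (auto simp: pinwheel_V_def)
  then show ?thesis unfolding knot_def hub_def rim_def bend_def by (elim disjE) simp_all
qed

lemma pinwheel_vertex_eqI:
  assumes "v \<in> pinwheel_V" "w \<in> pinwheel_V" "knot v = knot w" "v mod 4 = w mod 4"
  shows "v = w"
proof -
  have "hub v = hub w" "rim v = rim w" "bend v = bend w"
    using assms(4) by (simp_all add: hub_def rim_def bend_def)
  then show ?thesis
    using assms(3) pinwheel_V_cases[OF assms(1)] pinwheel_V_cases[OF assms(2)]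
    by (elim disjE conjE) linarith+
qed

lemma inj_on_pinwheel_pos: "inj_on pinwheel_pos pinwheel_V"
proof (rule inj_onI)
  fix v w assume vw: "v \<in> pinwheel_V" "w \<in> pinwheel_V" "pinwheel_pos v = pinwheel_pos w"
  then have "knot v = knot w" "v mod 4 = w mod 4"
    using arm_eq_armD[of v "knot v" w "knot w"] knot_bounds(1)[of v] knot_bounds(1)[of w]
    by (simp_all add: pinwheel_pos_def)
  then show "v = w" using vw(1,2) by (blast intro: pinwheel_vertex_eqI)
qed

lemma pinwheel_edge_avoids_vertices:
  assumes "e \<in> pinwheel_E" shows "pinwheel_pos w \<notin> pinwheel_edge e ` {0<..<1}"
proof
  assume "pinwheel_pos w \<in> pinwheel_edge e ` {0<..<1}"
  then obtain \<sigma> where \<sigma>: "\<sigma> \<in> open_segment (knot (fst e)) (1 / 2)"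
      "arm (real w) (knot w) = arm (real (fst e)) \<sigma>"
    unfolding pinwheel_edge_interior[OF assms] pinwheel_pos_def by blast
  from assms obtain z where z: "e = (z, bend z)" "knot z = -1 \<or> knot z = 2"
    by (rule pinwheel_E_cases)
  then have "-2 < \<sigma>" using \<sigma>(1) by (auto simp: open_segment_eq_real_ivl)
  then have "knot w = \<sigma>" using \<sigma>(2) knot_bounds(1)[of w] by (intro arm_eq_armD(1)) simp_all
  then show False using \<sigma>(1) z by (auto simp: open_segment_eq_real_ivl knot_def split: if_splits)
qed

lemma pinwheel_edges_Int:
  assumes e: "e \<in> pinwheel_E" and e': "e' \<in> pinwheel_E" and "e \<noteq> e'"
  shows "path_image (pinwheel_edge e) \<inter> path_image (pinwheel_edge e')
    \<subseteq> pinwheel_pos ` ({fst e, snd e} \<inter> {fst e', snd e'})"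
proof
  fix x assume x: "x \<in> path_image (pinwheel_edge e) \<inter> path_image (pinwheel_edge e')"
  obtain z where z: "e = (z, bend z)" "z < 8" "knot z = -1 \<or> knot z = 2"
    using e by (rule pinwheel_E_cases)
  obtain z' where z': "e' = (z', bend z')" "z' < 8" "knot z' = -1 \<or> knot z' = 2"
    using e' by (rule pinwheel_E_cases)
  obtain \<sigma> where \<sigma>: "x = arm (real z) \<sigma>" "\<sigma> \<in> closed_segment (knot z) (1 / 2)"
    using x unfolding path_image_pinwheel_edge z(1) by auto
  obtain \<sigma>' where \<sigma>': "x = arm (real z') \<sigma>'" "\<sigma>' \<in> closed_segment (knot z') (1 / 2)"
    using x unfolding path_image_pinwheel_edge z'(1) by auto
  have "-2 < \<sigma>" "-2 < \<sigma>'"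
    using \<sigma>(2) \<sigma>'(2) z(3) z'(3) by (auto simp: closed_segment_eq_real_ivl split: if_splits)
  moreover have "arm (real z) \<sigma> = arm (real z') \<sigma>'" using \<sigma>(1) \<sigma>'(1) by simp
  ultimately have "\<sigma> = \<sigma>'" and same_arm: "z mod 4 = z' mod 4" using arm_eq_armD by blast+
  have "knot z \<noteq> knot z'"
  proof
    assume "knot z = knot z'"
    then have "z = z'"
      using z(2) z'(2)
      by (intro pinwheel_vertex_eqI[OF _ _ _ same_arm]) (simp_all add: pinwheel_V_def)
    then show False using \<open>e \<noteq> e'\<close> z(1) z'(1) by simp
  qed
  then have "\<sigma> = 1 / 2"
    using \<sigma>(2) \<sigma>'(2) \<open>\<sigma> = \<sigma>'\<close> z(3) z'(3) by (auto simp: closed_segment_eq_real_ivl)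
  then have "x = pinwheel_pos (bend z)"
    using \<sigma>(1) by (simp only: pinwheel_pos_def knot_simps arm_pinwheel)
  moreover have "bend z = bend z'" using same_arm by (simp add: bend_def)
  ultimately show "x \<in> pinwheel_pos ` ({fst e, snd e} \<inter> {fst e', snd e'})" using z(1) z'(1) by simp
qed

lemma pinwheel_plane_drawing: "plane_drawing pinwheel_V pinwheel_E pinwheel_pos pinwheel_edge"
  unfolding plane_drawing_def
proof (intro conjI ballI impI)
  show "finite pinwheel_V" by (simp add: pinwheel_V_def)
  show "pinwheel_E \<subseteq> pinwheel_V \<times> pinwheel_V" by (auto simp: pinwheel_V_def pinwheel_E_def bend_def)
  show "inj_on pinwheel_pos pinwheel_V" by (rule inj_on_pinwheel_pos)
  fix e assume "e \<in> pinwheel_E"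
  then obtain z where z: "e = (z, bend z)" "z < 8" "knot z = -1 \<or> knot z = 2"
    by (rule pinwheel_E_cases)
  show "case e of (u, v) \<Rightarrow> u \<noteq> v \<and> (v, u) \<notin> pinwheel_E"
    using z by (auto simp: pinwheel_E_def bend_def)
  show "arc (pinwheel_edge e)" using z by (intro arc_pinwheel_edge) auto
  show "pathstart (pinwheel_edge e) = pinwheel_pos (fst e)"
    by (simp add: pinwheel_edge_def pathstart_compose pinwheel_pos_def)
  show "pathfinish (pinwheel_edge e) = pinwheel_pos (snd e)"
    using z by (simp add: pinwheel_edge_def pathfinish_compose pinwheel_pos_def)
qed (use pinwheel_edge_avoids_vertices pinwheel_edges_Int in blast)+

lemma pinwheel_drawing_bounded:
  "drawing_set pinwheel_V pinwheel_E pinwheel_pos pinwheel_edge \<subseteq> cball 0 4"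
proof -
  have arm_bound: "arm \<theta> \<sigma> \<in> cball 0 4" if "-1 \<le> \<sigma> \<and> \<sigma> \<le> 2" for \<theta> \<sigma>
    using that by (simp add: norm_arm)
  have "pinwheel_pos v \<in> cball 0 4" for v
    unfolding pinwheel_pos_def using knot_bounds by (intro arm_bound) blast
  moreover have "path_image (pinwheel_edge e) \<subseteq> cball 0 4" for e
    unfolding path_image_pinwheel_edge using arm_bound closed_segment_knot_bounds by blast
  ultimately show ?thesis unfolding drawing_set_def by blast
qed

lemma spoke_outside_pinwheel:
  assumes "4 < \<bar>t\<bar>"
  shows "spoke i t \<in> outside (drawing_set pinwheel_V pinwheel_E pinwheel_pos pinwheel_edge)"
proof -
  have "spoke i t \<in> outside (cball 0 4)" using assms by (simp add: outside_convex norm_spoke)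
  then show ?thesis using outside_mono[OF pinwheel_drawing_bounded] by blast
qed

lemma pinwheel_edge_meets_spoke_once:
  assumes e: "e \<in> pinwheel_E"
    and x: "x \<in> path_image (pinwheel_edge e) \<inter> range (spoke i)"
    and y: "y \<in> path_image (pinwheel_edge e) \<inter> range (spoke i)"
  shows "x = y"
proof -
  obtain z where z: "e = (z, bend z)" "knot z = -1 \<or> knot z = 2" using e by (rule pinwheel_E_cases)
  obtain \<sigma> \<tau> where \<sigma>\<tau>: "x = arm (real z) \<sigma>" "y = arm (real z) \<tau>"
      "\<sigma> \<in> closed_segment (knot z) (1 / 2)" "\<tau> \<in> closed_segment (knot z) (1 / 2)"
    using x y unfolding path_image_pinwheel_edge z(1) by auto
  then have bounds: "-2 < \<sigma>" "-2 < \<tau>" "\<bar>\<sigma> - \<tau>\<bar> < 2"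
    using z(2) by (auto simp: closed_segment_eq_real_ivl)
  then obtain m n :: int where "real z + \<sigma> = real i + 2 * of_int m"
      "real z + \<tau> = real i + 2 * of_int n"
    using x y \<sigma>\<tau>(1,2) by (auto simp: arm_in_spoke_iff)
  then have "\<sigma> - \<tau> = 2 * of_int (m - n)" by simp
  moreover from this have "of_int \<bar>m - n\<bar> < (1::real)" using bounds(3) by simp
  then have "m = n" by (simp only: of_int_less_1_iff)
  ultimately have "\<sigma> = \<tau>" by simp
  then show ?thesis using \<sigma>\<tau>(1,2) by simp
qed

lemma pseudoline_spoke: "pseudoline pinwheel_V pinwheel_E pinwheel_pos pinwheel_edge (spoke i)"
  unfolding pseudoline_def
proof (intro conjI ballI disjI2 allI impI)
  show "continuous_on UNIV (spoke i)" unfolding spoke_def by (intro continuous_intros)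
  have "dir (real i) \<noteq> 0" using norm_dir by (metis norm_zero zero_neq_one)
  then show "inj (spoke i)" by (auto simp: inj_def spoke_def)
  show "filterlim (\<lambda>t. norm (spoke i t)) at_top at_top"
    unfolding norm_spoke by (rule filterlim_abs_real)
  show "filterlim (\<lambda>t. norm (spoke i t)) at_top at_bot"
    unfolding norm_spoke by (simp add: filterlim_at_bot_mirror filterlim_abs_real)
  show "\<forall>\<^sub>F t in at_top. spoke i t \<in> outside
      (drawing_set pinwheel_V pinwheel_E pinwheel_pos pinwheel_edge)"
    using eventually_gt_at_top[of 4] by eventually_elim (simp add: spoke_outside_pinwheel)
  show "\<forall>\<^sub>F t in at_bot. spoke i t \<in> outside
      (drawing_set pinwheel_V pinwheel_E pinwheel_pos pinwheel_edge)"
    using eventually_gt_at_bot[of "-4"] by eventually_elim (simp add: spoke_outside_pinwheel)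
  fix e assume e: "e \<in> pinwheel_E"
  show "x = y" if "x \<in> path_image (pinwheel_edge e) \<inter> range (spoke i) \<and>
      y \<in> path_image (pinwheel_edge e) \<inter> range (spoke i)" for x y
    using that pinwheel_edge_meets_spoke_once[OF e] by blast
  fix t :: real assume t: "t \<in> {0<..<1}" "pinwheel_edge e t \<in> range (spoke i)"
  show "crosses_at (spoke i) (pinwheel_edge e) t"
    unfolding pinwheel_edge_def
  proof (rule spoke_crosses_arm)
    show "knot (fst e) \<noteq> knot (snd e)" using e by (rule pinwheel_E_cases) auto
    show "-1 \<le> linepath (knot (fst e)) (knot (snd e)) t"
      using t(1) closed_segment_knot_bounds[OF linepath_in_path[of t]] by simp
    show "arm (real (fst e)) (linepath (knot (fst e)) (knot (snd e)) t) \<in> range (spoke i)"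
      using t(2) by (simp add: pinwheel_edge_def)
  qed
qed

lemma pinwheel_star_aligned:
  "star_aligned_graph pinwheel_V pinwheel_E pinwheel_pos pinwheel_edge 2 spoke"
  unfolding star_aligned_graph_def aligned_graph_def
proof (intro conjI allI impI exI[of _ 0])
  fix i j :: nat assume ij: "i < 2" "j < 2" "i \<noteq> j"
  show Int: "range (spoke i) \<inter> range (spoke j) = {0}"
    using ij by (rule spokes_Int)
  show "p = q"
    if "p \<in> range (spoke i) \<inter> range (spoke j) \<and> q \<in> range (spoke i) \<inter> range (spoke j)" for p q
    using that unfolding Int by simp
  fix s assume "spoke j s \<in> range (spoke i)"
  then have "spoke j s = 0" using Int by blast
  then have "s = 0" using norm_spoke[of j s] by simp
  have "(sin ((real j - real i) * pi / 2))\<^sup>2 = 1"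
    using ij by (auto simp: less_2_cases_iff)
  then have "proj (real i + 1) (spoke j a) * proj (real i + 1) (spoke j b) = a * b" for a b
    by (simp add: spoke_def proj_Suc_scaleR_dir power2_eq_square)
  then show "crosses_at (spoke i) (spoke j) s"
    using \<open>s = 0\<close>
    by (intro crosses_at_zero_setI[OF range_spoke continuous_on_proj zero_less_one])
      (simp add: mult_neg_pos)
qed (use pinwheel_plane_drawing pseudoline_spoke in auto)

lemma pinwheel_anchored_once:
  assumes "e \<in> pinwheel_E"
  shows "on_pl 2 spoke (pinwheel_pos (fst e))" "\<not> on_pl 2 spoke (pinwheel_pos (snd e))"
    "anchoring pinwheel_pos 2 spoke e = 1"
proof -
  obtain z where z: "e = (z, bend z)" "knot z = -1 \<or> knot z = 2"
    using assms by (rule pinwheel_E_cases)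
  have on_pl_iff: "on_pl 2 spoke (pinwheel_pos v) \<longleftrightarrow> knot v \<in> \<int>" for v
    unfolding pinwheel_pos_def using knot_bounds(1)[of v] by (intro on_pl_arm_iff) simp
  have "(1 / 2 :: real) \<notin> \<int>"
    using frac_eq_0_iff[of "1 / 2 :: real"] frac_eq[of "1 / 2 :: real"] by simp
  then show "on_pl 2 spoke (pinwheel_pos (fst e))" "\<not> on_pl 2 spoke (pinwheel_pos (snd e))"
    using z by (auto simp: on_pl_iff)
  then show "anchoring pinwheel_pos 2 spoke e = 1" by (auto simp: anchoring_def on_pl_def)
qed

lemma pinwheel_crossing_number:
  assumes e: "e \<in> pinwheel_E" shows "crossing_number pinwheel_edge 2 spoke e \<le> 1"
proof -
  define crossed where "crossed = {i. i < 2 \<and> range (spoke i) \<inter> pinwheel_edge e ` {0<..<1} \<noteq> {}}"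
  obtain z where z: "e = (z, bend z)" "knot z = -1 \<or> knot z = 2" using e by (rule pinwheel_E_cases)
  have interior: "pinwheel_edge e ` {0<..<1} = arm (real z) ` open_segment (knot z) (1 / 2)"
    using pinwheel_edge_interior[OF e] z(1) by simp
  define \<tau> :: real where "\<tau> = (if knot z = -1 then 0 else 1)"
  have crossing: "arm (real z) \<tau> \<in> range (spoke i)" if crossed: "i \<in> crossed" for i
  proof -
    obtain x where x: "x \<in> range (spoke i)" "x \<in> arm (real z) ` open_segment (knot z) (1 / 2)"
      and "i < 2"
      using crossed unfolding crossed_def interior by blast
    obtain \<sigma> where \<sigma>: "\<sigma> \<in> open_segment (knot z) (1 / 2)" "x = arm (real z) \<sigma>" using x(2) by blast
    have bounds: "knot z = -1 \<and> -1 < \<sigma> \<and> \<sigma> < 1 / 2 \<or> knot z = 2 \<and> 1 / 2 < \<sigma> \<and> \<sigma> < 2"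
      using \<sigma>(1) z(2) by (auto simp: open_segment_eq_real_ivl)
    have "on_pl 2 spoke (arm (real z) \<sigma>)" using x(1) \<open>i < 2\<close> unfolding \<sigma>(2) on_pl_def by blast
    moreover have "-2 < \<sigma>" using bounds by auto
    ultimately have "\<sigma> \<in> \<int>" by (simp add: on_pl_arm_iff)
    then obtain n where n: "\<sigma> = of_int n" by (rule Ints_cases)
    then have "n = (if knot z = -1 then 0 else 1)"
      using bounds by (elim disjE conjE) (simp; linarith)+
    then show ?thesis using x(1) \<sigma>(2) n by (simp add: \<tau>_def split: if_splits)
  qed
  have "-2 < \<tau>" by (simp add: \<tau>_def)
  then have "i = j" if "i \<in> crossed" "j \<in> crossed" for i j
    using crossing[OF that(1)] crossing[OF that(2)] that
    by (auto simp: crossed_def intro: arm_in_spoke_unique)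
  moreover have "finite crossed" by (simp add: crossed_def)
  ultimately have "card crossed \<le> Suc 0" unfolding card_le_Suc0_iff_eq[OF \<open>finite crossed\<close>] by blast
  then show ?thesis by (simp add: crossing_number_def crossed_def)
qed

lemma pinwheel_alignment_complexity:
  "alignment_complexity pinwheel_E pinwheel_pos pinwheel_edge 2 spoke None (Some 1) None"
  unfolding alignment_complexity_def Let_def
proof (intro ballI conjI impI allI)
  fix i :: nat assume "i \<in> {0, 1, 2}" "[None, Some 1, None] ! i = None"
  then have "i \<noteq> 1" by auto
  then show "{e \<in> pinwheel_E. anchoring pinwheel_pos 2 spoke e = i} = {}"
    using pinwheel_anchored_once(3) by auto
next
  fix i m :: nat and e assume "i \<in> {0, 1, 2}" "[None, Some 1, None] ! i = Some m" "e \<in> pinwheel_E"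
  then show "crossing_number pinwheel_edge 2 spoke e \<le> m"
    using pinwheel_crossing_number[of e] by auto
qed

section \<open>Frames of aligned drawings\<close>

text \<open>Skew coordinates of a drawing: the sign of \<open>F q\<close> plays the role of the sign of \<open>proj q\<close>.\<close>

locale skew_frame =
  fixes F :: "nat \<Rightarrow> 'a::real_normed_vector \<Rightarrow> real"
  assumes affine: "affine_functional (F q)"
    and add_2: "F (q + 2) x = - F q x"
    and inj_0_1: "inj (\<lambda>x. (F 0 x, F 1 x))"
begin

lemma add_4: "F (q + 4) x = F q x"
  using add_2[of q x] add_2[of "q + 2" x] by (simp add: eval_nat_numeral)

lemma inj_pair: "inj (\<lambda>x. (F q x, F (q + 1) x))"
proof (induction q)
  case (Suc q)
  have "F (Suc q + 1) x = - F q x" for x using add_2[of q x] by simp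
  then show ?case using Suc by (auto simp: inj_def)
qed (use inj_0_1 in simp)

end

locale framed_drawing = skew_frame F
  for F :: "nat \<Rightarrow> pt \<Rightarrow> real" +
  fixes V :: "nat set" and E :: "(nat \<times> nat) set" and pos :: "nat \<Rightarrow> pt"
    and c :: "nat \<times> nat \<Rightarrow> real \<Rightarrow> pt" and p :: "nat \<Rightarrow> pt" and L :: "nat \<Rightarrow> pt \<times> pt"
  assumes aligned: "aligned_drawing V E pos c 2 spoke p L"
    and zero_iff: "F (q + 1) x = 0 \<longleftrightarrow> x \<in> range (line_curve (L (q mod 2)))"
    and vertex_sector: "v \<in> V \<Longrightarrow> pos v \<in> quadrant k \<Longrightarrow> p v \<in> sector F k"
    and edge_sectors: "e \<in> E \<Longrightarrow> path_meets_before (c e) (quadrant j) (quadrant k)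
      \<Longrightarrow> path_meets_before (seg p e) (sector F j) (sector F k)"
begin

lemma objects_on_line:
  assumes "i < 2" "X \<in> graph_objects V E" "range (spoke i) \<inter> obj pos c X \<noteq> {}"
  shows "range (line_curve (L i)) \<inter> obj p (seg p) X \<noteq> {}"
  using aligned assms unfolding aligned_drawing_def by blast

lemma objects_ordered_along_line:
  assumes "i < 2" "X \<in> graph_objects V E" "Y \<in> graph_objects V E"
    and "curve_meets_before (spoke i) (obj pos c X) (obj pos c Y)"
  shows "curve_meets_before (line_curve (L i)) (obj p (seg p) X) (obj p (seg p) Y)"
  using aligned assms unfolding aligned_drawing_def by blast

lemma vertex_on_ray:
  assumes v: "v \<in> V" "pos v = r *\<^sub>R dir (real q)"
  shows "F (q + 1) (p v) = 0"
proof -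
  have "Inl v \<in> graph_objects V E" using v(1) by (simp add: graph_objects_def)
  moreover have "range (spoke (q mod 2)) \<inter> obj pos c (Inl v) \<noteq> {}"
    using v(2) scaleR_dir_in_spoke[of r q] by (simp add: obj_def)
  ultimately have "range (line_curve (L (q mod 2))) \<inter> obj p (seg p) (Inl v) \<noteq> {}"
    by (intro objects_on_line) simp_all
  then show ?thesis unfolding zero_iff by (simp add: obj_def)
qed

lemma line_order_of_ray_order:
  assumes X: "X \<in> graph_objects V E" "r *\<^sub>R dir (real q) \<in> obj pos c X"
    and Y: "Y \<in> graph_objects V E" "s *\<^sub>R dir (real q) \<in> obj pos c Y"
    and "r < s"
  shows "if even (q div 2)
    then curve_meets_before (line_curve (L (q mod 2))) (obj p (seg p) X) (obj p (seg p) Y)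
    else curve_meets_before (line_curve (L (q mod 2))) (obj p (seg p) Y) (obj p (seg p) X)"
proof (cases "even (q div 2)")
  case True
  then have "spoke (q mod 2) r \<in> obj pos c X" "spoke (q mod 2) s \<in> obj pos c Y"
    using X Y by (simp_all add: scaleR_dir_eq_spoke)
  then have "curve_meets_before (spoke (q mod 2)) (obj pos c X) (obj pos c Y)"
    unfolding curve_meets_before_def using \<open>r < s\<close> by blast
  then show ?thesis using True X Y by (simp add: objects_ordered_along_line)
next
  case False
  then have "spoke (q mod 2) (- r) \<in> obj pos c X" "spoke (q mod 2) (- s) \<in> obj pos c Y"
    using X Y by (simp_all add: scaleR_dir_eq_spoke)
  moreover have "- s < - r" using \<open>r < s\<close> by simp
  ultimately have "curve_meets_before (spoke (q mod 2)) (obj pos c Y) (obj pos c X)"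
    unfolding curve_meets_before_def by blast
  then show ?thesis using False X Y by (simp add: objects_ordered_along_line)
qed

text \<open>The vertices \<open>v\<close> and \<open>w\<close> determine the direction of the line, so they fix the order of all
other objects on it.\<close>

lemma objects_ordered_on_ray:
  assumes v: "v \<in> V" "pos v = r\<^sub>0 *\<^sub>R dir (real q)" and w: "w \<in> V" "pos w = s\<^sub>0 *\<^sub>R dir (real q)"
    and vw: "r\<^sub>0 < s\<^sub>0" "F q (p v) < F q (p w)"
    and X: "X \<in> graph_objects V E" "r *\<^sub>R dir (real q) \<in> obj pos c X"
    and Y: "Y \<in> graph_objects V E" "s *\<^sub>R dir (real q) \<in> obj pos c Y"
    and "r < s"
  obtains x y where "x \<in> obj p (seg p) X" "F (q + 1) x = 0" "y \<in> obj p (seg p) Y" "F (q + 1) y = 0"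
    "F q x < F q y"
proof (cases "even (q div 2)")
  case True
  have "curve_meets_before (line_curve (L (q mod 2))) {p v} {p w}"
    using line_order_of_ray_order[of "Inl v" r\<^sub>0 q "Inl w" s\<^sub>0] v w vw(1) True
    by (simp add: graph_objects_def obj_def)
  moreover note \<open>F q (p v) < F q (p w)\<close>
  moreover have "curve_meets_before (line_curve (L (q mod 2))) (obj p (seg p) X) (obj p (seg p) Y)"
    using line_order_of_ray_order[OF X Y \<open>r < s\<close>] True by simp
  ultimately show ?thesis
    by (rule affine_functional_increasing_along_line[OF affine[of q]])
      (auto simp flip: zero_iff intro!: that)
next
  case False
  have "curve_meets_before (line_curve (L (q mod 2))) {p w} {p v}"
    using line_order_of_ray_order[of "Inl v" r\<^sub>0 q "Inl w" s\<^sub>0] v w vw(1) False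
    by (simp add: graph_objects_def obj_def)
  moreover have "- F q (p w) < - F q (p v)" using vw(2) by simp
  moreover have "curve_meets_before (line_curve (L (q mod 2))) (obj p (seg p) Y) (obj p (seg p) X)"
    using line_order_of_ray_order[OF X Y \<open>r < s\<close>] False by simp
  ultimately show ?thesis
    by (rule affine_functional_increasing_along_line[OF affine_functional_uminus[OF affine[of q]]])
      (auto simp flip: zero_iff intro!: that)
qed

lemma edge_start_neg:
  assumes "e \<in> E" "path_meets_before (c e) (quadrant j) (quadrant k)"
    and "\<And>x. x \<in> sector F j \<Longrightarrow> F i x < 0" "\<And>x. x \<in> sector F k \<Longrightarrow> 0 < F i x"
  shows "F i (p (fst e)) < 0"
proof -
  have "path_meets_before (seg p e) (sector F j) (sector F k)"
    using assms by (simp add: edge_sectors)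
  then obtain s t where "0 \<le> s" "s < t" "seg p e s \<in> sector F j" "seg p e t \<in> sector F k"
    by (auto simp: path_meets_before_def)
  then show ?thesis
    using assms(3,4) unfolding seg_def by (blast intro: affine_functional_neg_at_start[OF affine])
qed

end

fun frame_of :: "('a \<Rightarrow> real) \<Rightarrow> ('a \<Rightarrow> real) \<Rightarrow> nat \<Rightarrow> 'a \<Rightarrow> real" where
  "frame_of A B 0 x = A x"
| "frame_of A B (Suc 0) x = B x"
| "frame_of A B (Suc (Suc q)) x = - frame_of A B q x"

lemma skew_frame_of:
  assumes "affine_functional A" "affine_functional B" "inj (\<lambda>x. (A x, B x))"
  shows "skew_frame (frame_of A B)"
proof
  show "affine_functional (frame_of A B q)" for q
    by (induction q rule: nat_induct2) (use assms in \<open>simp_all add: affine_functional_def\<close>)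
qed (use assms(3) in simp_all)

lemma sgn_frame_of:
  assumes "\<And>x. sgn (A (g x)) = sgn (proj 0 x)" "\<And>x. sgn (B (g x)) = sgn (proj 1 x)"
  shows "sgn (frame_of A B q (g x)) = sgn (proj (real q) x)"
proof (induction q rule: nat_induct2)
  case (step q)
  then show ?case using proj_add_2[of "real q" x] by (simp add: add.commute sgn_minus)
qed (use assms in simp_all)

lemma frame_of_eq_0_iff:
  assumes "\<And>x. A x = 0 \<longleftrightarrow> x \<in> S 1" "\<And>x. B x = 0 \<longleftrightarrow> x \<in> S 0"
  shows "frame_of A B (q + 1) x = 0 \<longleftrightarrow> x \<in> S (q mod 2)"
  by (induction q rule: nat_induct2) (use assms in simp_all)

lemma image_sector:
  assumes "bij g" and sgn: "\<And>q x. sgn (F q (g x)) = sgn (G q x)"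
  shows "g ` sector G k = sector F k"
proof -
  have pos_iff: "0 < F q (g x) \<longleftrightarrow> 0 < G q x" for q x using sgn[of q x] by (metis sgn_1_pos)
  show ?thesis
  proof safe
    fix y assume "y \<in> sector F k"
    moreover obtain x where "y = g x" using \<open>bij g\<close> by (metis bij_pointE)
    ultimately show "y \<in> g ` sector G k" by (auto simp: sector_def pos_iff)
  qed (auto simp: sector_def pos_iff)
qed

lemma line_sign_transfer:
  assumes "homeomorphism UNIV UNIV g g'" and line: "g ` range (spoke i) = range (line_curve L)"
    and dir_L: "snd L \<noteq> 0"
  obtains s where "s \<noteq> 0" "\<And>x. sgn (s * line_functional L (g x)) = sgn (proj (real i + 1) x)"
proof -
  have "continuous_on UNIV g" "surj g" "inj g"
    using assms(1) by (auto simp: homeomorphism_def inj_on_def) metis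
  have zero: "line_functional L (g x) = 0 \<longleftrightarrow> proj (real i + 1) x = 0" for x
    using inj_image_mem_iff[OF \<open>inj g\<close>, of x "range (spoke i)"]
    by (simp add: line_functional_eq_0_iff[OF dir_L] flip: line) (simp add: range_spoke)
  have pos: "connected {x. 0 < proj (real i + 1) x}"
    by (simp add: proj_def convex_connected convex_halfspace_gt)
  have neg: "connected {x. proj (real i + 1) x < 0}"
    by (simp add: proj_def convex_connected convex_halfspace_lt)
  obtain y z where "0 < line_functional L y" "line_functional L z < 0"
    using line_functional_attains_signs[OF dir_L] .
  from continuous_sign_transfer[OF \<open>continuous_on UNIV g\<close> continuous_on_line_functional \<open>surj g\<close>
      zero pos neg this]
  show ?thesis using that by blast
qed

lemma aligned_drawing_cell_homeomorphism:
  assumes "aligned_drawing V E pos c k X p L"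
  defines "cells \<equiv> components (- (\<Union>i<k. range (X i)))"
  obtains g g' where "homeomorphism UNIV UNIV g g'"
    and "\<forall>i<k. g ` range (X i) = range (line_curve (L i))"
    and "\<forall>C\<in>cells. \<forall>v\<in>V. pos v \<in> C \<longleftrightarrow> p v \<in> g ` C"
    and "\<forall>e\<in>E. \<forall>C\<in>cells. \<forall>C'\<in>cells.
      path_meets_before (c e) C C' \<longleftrightarrow> path_meets_before (seg p e) (g ` C) (g ` C')"
  using assms(1) unfolding aligned_drawing_def Let_def cells_def
  by (elim conjE exE) (rule that, unfold cells_def, assumption+)

lemma spoke_lines_skew_frame:
  assumes homeo: "homeomorphism UNIV UNIV g g'"
    and lines: "\<And>i. i < 2 \<Longrightarrow> g ` range (spoke i) = range (line_curve (L i))"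
    and dirs: "snd (L 0) \<noteq> 0" "snd (L 1) \<noteq> 0"
  obtains F where "skew_frame F" "\<And>q x. F (q + 1) x = 0 \<longleftrightarrow> x \<in> range (line_curve (L (q mod 2)))"
    "\<And>q x. sgn (F q (g x)) = sgn (proj (real q) x)"
proof -
  obtain s where s: "s \<noteq> 0" "\<And>x. sgn (s * line_functional (L 0) (g x)) = sgn (proj 1 x)"
    using line_sign_transfer[OF homeo lines[of 0] dirs(1)] by auto
  obtain t where t: "t \<noteq> 0" "\<And>x. sgn (t * line_functional (L 1) (g x)) = sgn (proj 2 x)"
    using line_sign_transfer[OF homeo lines[of 1] dirs(2)] by auto
  define A B where "A x = - t * line_functional (L 1) x"
    and "B x = s * line_functional (L 0) x" for x
  have affine: "affine_functional A" "affine_functional B"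
    unfolding A_def B_def by (intro affine_functional_cmult affine_line_functional)+
  have "inj g" using homeo by (auto simp: homeomorphism_def inj_on_def) metis
  then have "g ` (range (spoke 0) \<inter> range (spoke 1))
      = range (line_curve (L 0)) \<inter> range (line_curve (L 1))"
    by (simp add: image_Int lines)
  then have "range (line_curve (L 0)) \<inter> range (line_curve (L 1)) = {g 0}" by (simp add: spokes_Int)
  from inj_line_functional_pair[OF this dirs] have inj: "inj (\<lambda>x. (A x, B x))"
    using s(1) t(1) by (auto simp: A_def B_def inj_def)
  have "skew_frame (frame_of A B)" using affine inj by (rule skew_frame_of)
  moreover have "frame_of A B (q + 1) x = 0 \<longleftrightarrow> x \<in> range (line_curve (L (q mod 2)))" for q x
    using s(1) t(1) dirs
    by (intro frame_of_eq_0_iff) (simp_all add: A_def B_def line_functional_eq_0_iff)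
  moreover have "sgn (frame_of A B q (g x)) = sgn (proj (real q) x)" for q x
    using s(2) t(2) proj_add_2[of 0] by (intro sgn_frame_of) (simp_all add: A_def B_def sgn_minus)
  ultimately show ?thesis by (rule that)
qed

lemma aligned_drawing_framed:
  assumes aligned: "aligned_drawing V E pos c 2 spoke p L"
  obtains F where "framed_drawing F V E pos c p L"
proof -
  have dirs: "snd (L 0) \<noteq> 0" "snd (L 1) \<noteq> 0" using aligned by (simp_all add: aligned_drawing_def)
  define cells where "cells = components (- (\<Union>i<2. range (spoke i)))"
  obtain g g' where homeo: "homeomorphism UNIV UNIV g g'"
    and lines: "\<forall>i<2. g ` range (spoke i) = range (line_curve (L i))"
    and vertices: "\<forall>C\<in>cells. \<forall>v\<in>V. pos v \<in> C \<longleftrightarrow> p v \<in> g ` C"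
    and edges: "\<forall>e\<in>E. \<forall>C\<in>cells. \<forall>C'\<in>cells.
      path_meets_before (c e) C C' \<longleftrightarrow> path_meets_before (seg p e) (g ` C) (g ` C')"
    using aligned_drawing_cell_homeomorphism[OF aligned, folded cells_def] .
  obtain F where F: "skew_frame F"
      "\<And>q x. F (q + 1) x = 0 \<longleftrightarrow> x \<in> range (line_curve (L (q mod 2)))"
    and sgn: "\<And>q x. sgn (F q (g x)) = sgn (proj (real q) x)"
    using spoke_lines_skew_frame[OF homeo lines[rule_format] dirs] by blast
  have "bij g" using homeo by (auto simp: homeomorphism_def bij_def inj_on_def) metis
  then have sectors: "g ` quadrant k = sector F k" for k
    unfolding quadrant_def using sgn by (rule image_sector)
  have cells: "quadrant k \<in> cells" for k
    unfolding cells_def by (rule quadrant_in_components)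
  have "framed_drawing F V E pos c p L"
  proof (intro framed_drawing.intro framed_drawing_axioms.intro)
    show "p v \<in> sector F k" if "v \<in> V" "pos v \<in> quadrant k" for v k
      using vertices[rule_format, OF cells that(1)] that(2) by (simp add: sectors)
    show "path_meets_before (seg p e) (sector F j) (sector F k)"
      if "e \<in> E" "path_meets_before (c e) (quadrant j) (quadrant k)" for e j k
      using edges[rule_format, OF that(1) cells cells] that(2) by (simp add: sectors)
  qed (fact F aligned)+
  then show ?thesis by (rule that)
qed

lemma plane_drawing_edges_Int:
  assumes "plane_drawing V E pos c" "e \<in> E" "e' \<in> E" "e \<noteq> e'"
  shows "path_image (c e) \<inter> path_image (c e') \<subseteq> pos ` ({fst e, snd e} \<inter> {fst e', snd e'})"
  using assms unfolding plane_drawing_def by blast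

section \<open>Spiral arms in aligned drawings\<close>

definition spiral_arm ::
  "nat set \<Rightarrow> (nat \<times> nat) set \<Rightarrow> (nat \<Rightarrow> pt) \<Rightarrow> (nat \<times> nat \<Rightarrow> real \<Rightarrow> pt)
     \<Rightarrow> nat \<Rightarrow> nat \<Rightarrow> nat \<Rightarrow> nat \<Rightarrow> bool" where
  "spiral_arm V E pos c q a u b \<longleftrightarrow>
     a \<in> V \<and> u \<in> V \<and> b \<in> V \<and> (a, u) \<in> E \<and> (b, u) \<in> E \<and>
     pos a = arm (real q) (-1) \<and> pos u = arm (real q) (1 / 2) \<and> pos b = arm (real q) 2 \<and>
     c (a, u) = arm (real q) \<circ> linepath (-1) (1 / 2) \<and> c (b, u) = arm (real q) \<circ> linepath 2 (1 / 2)"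

lemma arm_in_quadrant:
  "-2 < \<sigma> \<Longrightarrow> real k < real q + \<sigma> \<Longrightarrow> real q + \<sigma> < real k + 1 \<Longrightarrow> arm (real q) \<sigma> \<in> quadrant k"
  by (simp add: arm_def scaleR_dir_in_quadrant)

lemma inner_half_meets_quadrants:
  "path_meets_before (arm (real q) \<circ> linepath (-1) (1 / 2)) (quadrant (q + 3)) (quadrant q)"
proof -
  have "(arm (real q) \<circ> linepath (-1) (1 / 2)) (1 / 3) \<in> quadrant (q + 3)"
    using arm_in_quadrant[of "- 1 / 2" "q + 3" "q + 4"] arm_cong_mod_4[of "q + 4" q]
    by (simp add: linepath_def)
  moreover have "(arm (real q) \<circ> linepath (-1) (1 / 2)) 1 \<in> quadrant q"
    using arm_in_quadrant[of "1 / 2" q q] by (simp add: linepath_1')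
  ultimately show ?thesis
    unfolding path_meets_before_def by (intro exI[of _ "1 / 3"] exI[of _ 1]) simp
qed

lemma outer_half_meets_quadrants:
  "path_meets_before (arm (real q) \<circ> linepath 2 (1 / 2)) (quadrant (q + 1)) (quadrant q)"
proof -
  have "(arm (real q) \<circ> linepath 2 (1 / 2)) (1 / 3) \<in> quadrant (q + 1)"
    using arm_in_quadrant[of "3 / 2" "q + 1" q] by (simp add: linepath_def)
  moreover have "(arm (real q) \<circ> linepath 2 (1 / 2)) 1 \<in> quadrant q"
    using arm_in_quadrant[of "1 / 2" q q] by (simp add: linepath_1')
  ultimately show ?thesis
    unfolding path_meets_before_def by (intro exI[of _ "1 / 3"] exI[of _ 1]) simp
qed

lemma inner_half_on_ray: "2 *\<^sub>R dir (real q) \<in> path_image (arm (real q) \<circ> linepath (-1) (1 / 2))"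
proof -
  have "2 *\<^sub>R dir (real q) = arm (real q) 0" by (simp add: arm_def)
  then show ?thesis by (simp add: path_image_compose closed_segment_eq_real_ivl)
qed

lemma outer_half_on_ray: "3 *\<^sub>R dir (real (q + 1)) \<in> path_image (arm (real q) \<circ> linepath 2 (1 / 2))"
proof -
  have "3 *\<^sub>R dir (real (q + 1)) = arm (real q) 1" by (simp add: arm_def add.commute)
  then show ?thesis by (simp add: path_image_compose closed_segment_eq_real_ivl)
qed

lemma consecutive_arms_disjoint: "-2 < \<sigma> \<Longrightarrow> -2 < \<tau> \<Longrightarrow> arm (real (q + 1)) \<sigma> \<noteq> arm (real q) \<tau>"
proof
  assume "-2 < \<sigma>" "-2 < \<tau>" "arm (real (q + 1)) \<sigma> = arm (real q) \<tau>"
  then have "(q + 1) mod 4 = q mod 4" using arm_eq_armD(2) by blast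
  then show False by presburger
qed

lemma (in framed_drawing) spiral_arm_signs:
  assumes "spiral_arm V E pos c q a u b"
  shows "0 < F q (p u)" "0 < F (q + 1) (p u)"
    "F q (p a) = 0" "F (q + 1) (p a) < 0"
    "F q (p b) < 0" "F (q + 1) (p b) = 0"
proof -
  note spiral_arm = assms[unfolded spiral_arm_def]
  have "pos u \<in> quadrant q" using spiral_arm arm_in_quadrant[of "1 / 2" q q] by simp
  then have "p u \<in> sector F q" using spiral_arm vertex_sector by blast
  then show "0 < F q (p u)" "0 < F (q + 1) (p u)" by (simp_all add: sector_def)
  have "pos a = 1 *\<^sub>R dir (real (q + 3))"
    using spiral_arm dir_add_4_mult[of "real q - 1" 1] by (simp add: arm_def add.commute)
  then have "F (q + 3 + 1) (p a) = 0" using spiral_arm by (blast intro: vertex_on_ray)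
  then show "F q (p a) = 0" using add_4[of q] by (simp add: add_ac)
  have "pos b = 4 *\<^sub>R dir (real (q + 2))" using spiral_arm by (simp add: arm_def add.commute)
  then have "F (q + 2 + 1) (p b) = 0" using spiral_arm by (blast intro: vertex_on_ray)
  then show "F (q + 1) (p b) = 0" using add_2[of "q + 1"] by (simp add: add_ac)
  have "F (q + 1) x < 0" if "x \<in> sector F (q + 3)" for x
    using that add_2[of "q + 1" x] by (simp add: sector_def numeral_3_eq_3)
  moreover have "0 < F (q + 1) x" if "x \<in> sector F q" for x using that by (simp add: sector_def)
  ultimately show "F (q + 1) (p a) < 0"
    using edge_start_neg[of "(a, u)" "q + 3" q] spiral_arm inner_half_meets_quadrants by simp
  have "F q x < 0" if "x \<in> sector F (q + 1)" for x
    using that add_2[of q x] by (simp add: sector_def)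
  moreover have "0 < F q x" if "x \<in> sector F q" for x using that by (simp add: sector_def)
  ultimately show "F q (p b) < 0"
    using edge_start_neg[of "(b, u)" "q + 1" q] spiral_arm outer_half_meets_quadrants by simp
qed

lemma (in framed_drawing) objects_ordered_between_spiral_arms:
  assumes first_arm: "spiral_arm V E pos c q a u b"
    and second_arm: "spiral_arm V E pos c (q + 1) a' u' b'"
    and objects: "X \<in> graph_objects V E" "r *\<^sub>R dir (real q) \<in> obj pos c X"
      "Y \<in> graph_objects V E" "s *\<^sub>R dir (real q) \<in> obj pos c Y" "r < s"
  obtains x y where "x \<in> obj p (seg p) X" "F (q + 1) x = 0" "y \<in> obj p (seg p) Y" "F (q + 1) y = 0"
    "F q x < F q y"
proof (rule objects_ordered_on_ray)
  show "b \<in> V" "a' \<in> V" using first_arm second_arm by (simp_all add: spiral_arm_def)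
  show "pos b = (-4) *\<^sub>R dir (real q)"
    using first_arm dir_add_2[of "real q"] by (simp add: spiral_arm_def arm_def)
  show "pos a' = 1 *\<^sub>R dir (real q)" using second_arm by (simp add: spiral_arm_def arm_def)
  have "F q (p b) < 0" using first_arm by (rule spiral_arm_signs)
  also have "0 < F q (p a')" using spiral_arm_signs(4)[OF second_arm] add_2[of q] by simp
  finally show "F q (p b) < F q (p a')" .
qed (use objects that in auto)

lemma (in framed_drawing) inner_half_slope:
  assumes first_arm: "spiral_arm V E pos c q a u b"
    and second_arm: "spiral_arm V E pos c (q + 1) a' u' b'"
  shows "- F (q + 2) (p a') * F (q + 1) (p u) < - F (q + 1) (p a) * F q (p u)"
proof -
  have F_hub: "F q (p a') = - F (q + 2) (p a')" using add_2[of q] by simp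
  have hub: "Inl a' \<in> graph_objects V E" "1 *\<^sub>R dir (real q) \<in> obj pos c (Inl a')"
    using second_arm by (simp_all add: spiral_arm_def graph_objects_def obj_def arm_def)
  have edge: "Inr (a, u) \<in> graph_objects V E" "2 *\<^sub>R dir (real q) \<in> obj pos c (Inr (a, u))"
    using first_arm inner_half_on_ray by (simp_all add: spiral_arm_def graph_objects_def obj_def)
  obtain x where x: "x \<in> closed_segment (p a) (p u)" "F (q + 1) x = 0" "F q (p a') < F q x"
    using objects_ordered_between_spiral_arms[OF first_arm second_arm hub edge]
    by (auto simp: obj_def seg_def)
  have "0 < F q (p a')" using spiral_arm_signs(4)[OF second_arm] F_hub by simp
  then have "F q (p a') * F (q + 1) (p u) < - F (q + 1) (p a) * F q (p u)"
    using crossing_slope_bound[OF affine affine _ _ _ x(1,2)] spiral_arm_signs[OF first_arm] x(3)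
    by blast
  then show ?thesis by (simp only: F_hub)
qed

lemma (in framed_drawing) bend_trapped_by_outer_half:
  assumes first_arm: "spiral_arm V E pos c q a u b"
    and second_arm: "spiral_arm V E pos c (q + 1) a' u' b'"
    and third_arm: "spiral_arm V E pos c (q + 2) a'' u'' b''"
  shows "F (q + 1) (p u') < F (q + 1) (p u)"
proof -
  have inner: "Inr (a', u') \<in> graph_objects V E"
    "2 *\<^sub>R dir (real (q + 1)) \<in> obj pos c (Inr (a', u'))"
    using second_arm inner_half_on_ray[of "q + 1"]
    by (simp_all add: spiral_arm_def graph_objects_def obj_def)
  have outer: "Inr (b, u) \<in> graph_objects V E"
    "3 *\<^sub>R dir (real (q + 1)) \<in> obj pos c (Inr (b, u))"
    using first_arm outer_half_on_ray by (simp_all add: spiral_arm_def graph_objects_def obj_def)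
  have "spiral_arm V E pos c (q + 1 + 1) a'' u'' b''" using third_arm by simp
  from objects_ordered_between_spiral_arms[OF second_arm this inner outer]
  obtain x y where xy: "x \<in> closed_segment (p a') (p u')" "F (q + 2) x = 0"
    "y \<in> closed_segment (p b) (p u)" "F (q + 2) y = 0" "F (q + 1) x < F (q + 1) y"
    by (auto simp: obj_def seg_def)
  have "pos ` {a', u'} \<inter> pos ` {b, u} = {}"
    using first_arm second_arm consecutive_arms_disjoint[where q = q] by (auto simp: spiral_arm_def)
  then have "{a', u'} \<inter> {b, u} = {}" by blast
  moreover have "plane_drawing V E p (seg p)" using aligned by (simp add: aligned_drawing_def)
  ultimately have disjoint: "closed_segment (p a') (p u') \<inter> closed_segment (p b) (p u) = {}"
    using plane_drawing_edges_Int[of V E p "seg p" "(a', u')" "(b, u)"] first_arm second_arm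
    by (auto simp: seg_def spiral_arm_def)
  show ?thesis
  proof (rule quadrant_edge_trapped[OF affine affine])
    show "inj (\<lambda>x. (F (q + 1) x, F (q + 2) x))" using inj_pair[of "q + 1"] by simp
    show "0 < F (q + 2) (p b)" using spiral_arm_signs(5)[OF first_arm] add_2[of q] by simp
    show "F (q + 2) (p a') < 0" "0 < F (q + 2) (p u')"
      using spiral_arm_signs[OF second_arm] by simp_all
  qed (use xy spiral_arm_signs[OF first_arm] spiral_arm_signs[OF second_arm] disjoint in simp_all)
qed

lemma (in framed_drawing) hub_bend_product_decreasing:
  assumes first_arm: "spiral_arm V E pos c q a u b"
    and second_arm: "spiral_arm V E pos c (q + 1) a' u' b'"
    and third_arm: "spiral_arm V E pos c (q + 2) a'' u'' b''"
  shows "- F (q + 3) (p a'') * F (q + 2) (p u') < - F (q + 2) (p a') * F (q + 1) (p u)"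
proof -
  have "- F (q + 3) (p a'') * F (q + 2) (p u') < - F (q + 2) (p a') * F (q + 1) (p u')"
    using inner_half_slope[OF second_arm, of a'' u'' b''] third_arm by (simp add: numeral_3_eq_3)
  also have "\<dots> < - F (q + 2) (p a') * F (q + 1) (p u)"
    using bend_trapped_by_outer_half[OF first_arm second_arm third_arm]
      spiral_arm_signs(4)[OF second_arm]
    by (intro mult_strict_left_mono) simp_all
  finally show ?thesis .
qed

section \<open>The pinwheel has no aligned drawing\<close>

lemma spiral_arm_pinwheel:
  "spiral_arm pinwheel_V pinwheel_E pinwheel_pos pinwheel_edge q (hub q) (bend q) (rim q)"
  using pinwheel_vertices pinwheel_edges
  by (simp add: spiral_arm_def pinwheel_pos_def pinwheel_edge_def)

lemma no_aligned_drawing_pinwheel: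
  "\<not> aligned_drawing pinwheel_V pinwheel_E pinwheel_pos pinwheel_edge 2 spoke p L"
proof
  assume "aligned_drawing pinwheel_V pinwheel_E pinwheel_pos pinwheel_edge 2 spoke p L"
  then obtain F where "framed_drawing F pinwheel_V pinwheel_E pinwheel_pos pinwheel_edge p L"
    by (rule aligned_drawing_framed)
  then interpret framed_drawing F pinwheel_V pinwheel_E pinwheel_pos pinwheel_edge p L .
  define hub_bend_product
    where "hub_bend_product q = - F (q + 2) (p (hub (q + 1))) * F (q + 1) (p (bend q))" for q
  have "hub_bend_product (Suc q) < hub_bend_product q" for q
    using hub_bend_product_decreasing[OF spiral_arm_pinwheel spiral_arm_pinwheel
        spiral_arm_pinwheel, of q]
    by (simp add: hub_bend_product_def numeral_3_eq_3)
  then have "hub_bend_product 4 < hub_bend_product 0"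
    using lift_Suc_mono_less[of "\<lambda>q. - hub_bend_product q" 0 4] by simp
  moreover have "hub_bend_product 4 = hub_bend_product 0"
    using add_4[of 1] add_4[of 2]
    by (simp add: hub_bend_product_def hub_def bend_def numeral_2_eq_2)
  ultimately show False by simp
qed

theorem theorem1:
  shows "\<exists>(V::nat set) (E::(nat \<times> nat) set) (pos::nat \<Rightarrow> pt) (c::nat \<times> nat \<Rightarrow> real \<Rightarrow> pt)
           (X::nat \<Rightarrow> real \<Rightarrow> pt).
     star_aligned_graph V E pos c 2 X \<and>
     alignment_complexity E pos c 2 X None (Some 1) None \<and>
     (\<forall>e\<in>E. (on_pl 2 X (pos (fst e)) \<longleftrightarrow> \<not> on_pl 2 X (pos (snd e))) \<and> crossing_number c 2 X e \<le> 1) \<and>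
     \<not> (\<exists>p L. aligned_drawing V E pos c 2 X p L)"
proof (intro exI conjI ballI)
  show "star_aligned_graph pinwheel_V pinwheel_E pinwheel_pos pinwheel_edge 2 spoke"
    by (rule pinwheel_star_aligned)
  show "alignment_complexity pinwheel_E pinwheel_pos pinwheel_edge 2 spoke None (Some 1) None"
    by (rule pinwheel_alignment_complexity)
  show "\<not> (\<exists>p L. aligned_drawing pinwheel_V pinwheel_E pinwheel_pos pinwheel_edge 2 spoke p L)"
    by (simp add: no_aligned_drawing_pinwheel)
  fix e assume e: "e \<in> pinwheel_E"
  show "on_pl 2 spoke (pinwheel_pos (fst e)) \<longleftrightarrow> \<not> on_pl 2 spoke (pinwheel_pos (snd e))"
    using pinwheel_anchored_once[OF e] by simp
  show "crossing_number pinwheel_edge 2 spoke e \<le> 1"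
    using e by (rule pinwheel_crossing_number)
qed

end
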